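(* Let $n\geq1$. The group operations associated to the Lie-Cholesky group structure on $\mathrm{Cor}^+(n)$ are, for all $C,C',C_1,\dots,C_k\in\mathrm{Cor}^+(n)$ ($k\geq 1$), $X\in T_C\mathrm{Cor}^+(n)\simeq\mathrm{Hol}(n)$, $t\in\mathbb{R}$: - (Exponential map) $\mathrm{Exp}_C(tX)=\Theta^{-1}\big(\Theta(C)\exp(t\,\Theta(C)^{-1}d_C\Theta(X))\big)$; - (Logarithm map) $\mathrm{Log}_C(C')=(d_C\Theta)^{-1}\big(\Theta(C)\log(\Theta(C)^{-1}\Theta(C'))\big)$; - (Geodesic from $C$ at $t=0$ to $C'$ at $t=1$) $\gamma_{C\to C'}(t)=\Theta^{-1}\big(\Theta(C)(\Theta(C)^{-1}\Theta(C'))^t\big)$; - (Group mean) the group mean $\bar C$ of $C_1,\dots,C_k$ is unique and is characterized by $\sum_{i=1}^k\log(\Theta(\bar C)^{-1}\Theta(C_i))=0$.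
   Context: $\mathrm{Cor}^+(n)$ is the manifold of real symmetric positive definite $n\times n$ matrices with unit diagonal; $\mathrm{Hol}(n)$ is the space of symmetric matrices with zero diagonal. $\mathrm{LT}^0(n)$ is the nilpotent Lie algebra of strictly lower triangular matrices and $\mathrm{LT}^1(n)=I_n+\mathrm{LT}^0(n)$ the Lie group (for matrix multiplication) of lower triangular matrices with unit diagonal. $\exp:\mathrm{LT}^0(n)\to\mathrm{LT}^1(n)$ is the matrix exponential, a diffeomorphism, with inverse $\log(Z)=\sum_{k=1}^{n-1}\frac{(-1)^{k-1}}{k}(Z-I_n)^k$; for $Z\in\mathrm{LT}^1(n)$ and $t\in\mathbb{R}$, $Z^t=\exp(t\log Z)$. $\mathrm{Diag}(M)$ is the diagonal matrix with the same diagonal as $M$, and $\mathrm{Chol}(C)$ is the unique lower triangular $L$ with positive diagonal such that $C=LL^\top$. The map $\Theta:\mathrm{Cor}^+(n)\to\mathrm{LT}^1(n)$, $\Theta(C)=\mathrm{Diag}(\mathrm{Chol}(C))^{-1}\mathrm{Chol}(C)$, is a diffeomorphism. The Lie-Cholesky group structure on $\mathrm{Cor}^+(n)$ is the Lie group structure transported from $\mathrm{LT}^1(n)$ by $\Theta$. It is endowed with its canonical Cartan-Schouten connection, i.e. the left-invariant affine connection with $\nabla_XY=\frac12[X,Y]$ for left-invariant vector fields $X,Y$, whose geodesics are the left translates of one-parameter subgroups. $\mathrm{Exp}_C$, $\mathrm{Log}_C=(\mathrm{Exp}_C)^{-1}$ and geodesics refer to this connection. A group mean of $C_1,\dots,C_k$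 is a point $\bar C$ such that $\sum_{i=1}^k\mathrm{Log}_{\bar C}(C_i)=0$. *)

theory Defs
  imports "HOL-Analysis.Analysis"
begin

text \<open>
  Matrices of size \<open>n\<close> are indexed by an arbitrary type of class \<open>{finite, wellorder}\<close>, as for
  the triangular determinants in \<^theory>\<open>HOL-Analysis.Determinants\<close>; \<open>n\<close> is \<open>CARD('n)\<close>, so
  \<open>n \<ge> 1\<close> holds automatically.
\<close>

type_synonym 'n sqmat = "real ^ 'n ^ 'n"

section \<open>Matrix spaces\<close>

definition Cor_plus :: "'n::{finite,wellorder} sqmat set" where
  "Cor_plus = {C. transpose C = C \<and> (\<forall>x. x \<noteq> 0 \<longrightarrow> x \<bullet> (C *v x) > 0) \<and> (\<forall>i. C $ i $ i = 1)}"

definition Hol :: "'n::{finite,wellorder} sqmat set" where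
  "Hol = {X. transpose X = X \<and> (\<forall>i. X $ i $ i = 0)}"

definition lower_triangular :: "'n::{finite,wellorder} sqmat \<Rightarrow> bool" where
  "lower_triangular M \<longleftrightarrow> (\<forall>i j. i < j \<longrightarrow> M $ i $ j = 0)"

definition LT0 :: "'n::{finite,wellorder} sqmat set" where
  "LT0 = {A. lower_triangular A \<and> (\<forall>i. A $ i $ i = 0)}"

definition LT1 :: "'n::{finite,wellorder} sqmat set" where
  "LT1 = {mat 1 + A | A. A \<in> LT0}"

section \<open>Matrix exponential, logarithm and powers\<close>

text \<open>
  The library operations \<open>*\<close>, \<open>^\<close> on vectors act componentwise, and \<^const>\<open>exp\<close> is not
  available for the matrix product, hence the following definitions.
\<close>

primrec mpow :: "'n::{finite,wellorder} sqmat \<Rightarrow> nat \<Rightarrow> 'n sqmat" where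
  "mpow A 0 = mat 1"
| "mpow A (Suc k) = A ** mpow A k"

definition mexp :: "'n::{finite,wellorder} sqmat \<Rightarrow> 'n sqmat" where
  "mexp A = (\<Sum>k. (1 / fact k) *\<^sub>R mpow A k)"

definition mlog :: "'n::{finite,wellorder} sqmat \<Rightarrow> 'n sqmat" where
  "mlog Z = (\<Sum>k = 1..CARD('n) - 1. ((- 1) ^ (k - 1) / real k) *\<^sub>R mpow (Z - mat 1) k)"

definition mpowr :: "'n::{finite,wellorder} sqmat \<Rightarrow> real \<Rightarrow> 'n sqmat" where
  "mpowr Z t = mexp (t *\<^sub>R mlog Z)"

section \<open>The map \<open>\<Theta>\<close>\<close>

definition Diag :: "'n::{finite,wellorder} sqmat \<Rightarrow> 'n sqmat" where
  "Diag M = (\<chi> i j. if i = j then M $ i $ j else 0)"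

definition Chol :: "'n::{finite,wellorder} sqmat \<Rightarrow> 'n sqmat" where
  "Chol C = (THE L. lower_triangular L \<and> (\<forall>i. L $ i $ i > 0) \<and> C = L ** transpose L)"

definition Theta :: "'n::{finite,wellorder} sqmat \<Rightarrow> 'n sqmat" where
  "Theta C = matrix_inv (Diag (Chol C)) ** Chol C"

definition Theta_inv :: "'n::{finite,wellorder} sqmat \<Rightarrow> 'n sqmat" where
  "Theta_inv = the_inv_into Cor_plus Theta"

text \<open>
  \<^const>\<open>Cor_plus\<close> is open in the affine space \<open>mat 1 + Hol\<close>, so each of its tangent spaces is
  \<^const>\<open>Hol\<close>, and the derivative at \<open>C\<close> within \<^const>\<open>Cor_plus\<close> of a differentiable map is
  uniquely determined on \<^const>\<open>Hol\<close> (although not on all matrices).  Below it is only applied to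
  elements of \<^const>\<open>Hol\<close>.
\<close>

definition diff_at ::
    "('n::{finite,wellorder} sqmat \<Rightarrow> 'n sqmat) \<Rightarrow> 'n sqmat \<Rightarrow> 'n sqmat \<Rightarrow> 'n sqmat" where
  "diff_at f C = frechet_derivative f (at C within Cor_plus)"

definition diff_inv_at ::
    "('n::{finite,wellorder} sqmat \<Rightarrow> 'n sqmat) \<Rightarrow> 'n sqmat \<Rightarrow> 'n sqmat \<Rightarrow> 'n sqmat" where
  "diff_inv_at f C = the_inv_into Hol (diff_at f C)"

section \<open>The Lie-Cholesky group and its canonical Cartan-Schouten connection\<close>

definition lc_mult :: "'n::{finite,wellorder} sqmat \<Rightarrow> 'n sqmat \<Rightarrow> 'n sqmat" where
  "lc_mult C C' = Theta_inv (Theta C ** Theta C')"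

definition left_invariant_field :: "('n::{finite,wellorder} sqmat \<Rightarrow> 'n sqmat) \<Rightarrow> bool" where
  "left_invariant_field X \<longleftrightarrow>
     (\<forall>C\<in>Cor_plus. X C \<in> Hol) \<and>
     (\<forall>A\<in>Cor_plus. \<forall>C\<in>Cor_plus. diff_at (lc_mult A) C (X C) = X (lc_mult A C))"

definition lie_bracket ::
    "('n::{finite,wellorder} sqmat \<Rightarrow> 'n sqmat) \<Rightarrow> ('n sqmat \<Rightarrow> 'n sqmat) \<Rightarrow> 'n sqmat \<Rightarrow> 'n sqmat"
  where
  "lie_bracket X Y C = diff_at Y C (X C) - diff_at X C (Y C)"

text \<open>
  Since \<^const>\<open>Cor_plus\<close> is an open subset of an affine space, it has a global chart, in which an
  affine connection is given by its Christoffel map: \<open>\<nabla>\<^sub>X Y = dY(X) + \<Gamma>(X, Y)\<close>, where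
  \<open>\<Gamma> C\<close> is a bilinear map on the tangent space \<^const>\<open>Hol\<close>.  Each such map extends to a
  bilinear map on all matrices; the extension is irrelevant.
\<close>

type_synonym 'n christoffel = "'n sqmat \<Rightarrow> 'n sqmat \<Rightarrow> 'n sqmat \<Rightarrow> 'n sqmat"

definition affine_connection :: "'n::{finite,wellorder} christoffel \<Rightarrow> bool" where
  "affine_connection \<Gamma> \<longleftrightarrow>
     (\<forall>C\<in>Cor_plus. bilinear (\<Gamma> C) \<and> (\<forall>V\<in>Hol. \<forall>W\<in>Hol. \<Gamma> C V W \<in> Hol))"

definition cov_deriv ::
    "'n::{finite,wellorder} christoffel \<Rightarrow>
     ('n sqmat \<Rightarrow> 'n sqmat) \<Rightarrow> ('n sqmat \<Rightarrow> 'n sqmat) \<Rightarrow> 'n sqmat \<Rightarrow> 'n sqmat" where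
  "cov_deriv \<Gamma> X Y C = diff_at Y C (X C) + \<Gamma> C (X C) (Y C)"

definition left_invariant_connection :: "'n::{finite,wellorder} christoffel \<Rightarrow> bool" where
  "left_invariant_connection \<Gamma> \<longleftrightarrow>
     (\<forall>X Y. left_invariant_field X \<longrightarrow> left_invariant_field Y \<longrightarrow>
        left_invariant_field (cov_deriv \<Gamma> X Y))"

text \<open>
  Left-invariant fields through a point take every tangent vector as value, so the last condition
  determines \<open>\<Gamma> C\<close> on \<^const>\<open>Hol\<close>.  In particular smoothness of the connection need not be
  required separately, and the choice operator below picks a unique connection.
\<close>

definition cartan_schouten :: "'n::{finite,wellorder} christoffel \<Rightarrow> bool" where
  "cartan_schouten \<Gamma> \<longleftrightarrow>
     affine_connection \<Gamma> \<and> left_invariant_connection \<Gamma> \<and>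
     (\<forall>X Y. left_invariant_field X \<longrightarrow> left_invariant_field Y \<longrightarrow>
        (\<forall>C\<in>Cor_plus. cov_deriv \<Gamma> X Y C = (1 / 2) *\<^sub>R lie_bracket X Y C))"

definition lc_connection :: "'n::{finite,wellorder} christoffel" where
  "lc_connection = (SOME \<Gamma>. cartan_schouten \<Gamma>)"

text \<open>
  The geodesic equation is \<open>\<nabla>\<^bsub>\<gamma>'\<^esub> \<gamma>' = \<gamma>'' + \<Gamma>(\<gamma>', \<gamma>') = 0\<close>;
  \<open>v\<close> and \<open>a\<close> are the first and second derivatives of \<open>\<gamma>\<close>.
\<close>

definition lc_geodesic_on :: "real set \<Rightarrow> (real \<Rightarrow> 'n::{finite,wellorder} sqmat) \<Rightarrow> bool" where
  "lc_geodesic_on J \<gamma> \<longleftrightarrow>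
     (\<exists>v a. \<forall>t\<in>J. \<gamma> t \<in> Cor_plus \<and>
        (\<gamma> has_vector_derivative v t) (at t within J) \<and>
        (v has_vector_derivative a t) (at t within J) \<and>
        a t + lc_connection (\<gamma> t) (v t) (v t) = 0)"

definition lc_Exp :: "'n::{finite,wellorder} sqmat \<Rightarrow> 'n sqmat \<Rightarrow> 'n sqmat" where
  "lc_Exp C X = (THE C'. \<exists>\<gamma>. lc_geodesic_on {0..1} \<gamma> \<and> \<gamma> 0 = C \<and>
     (\<gamma> has_vector_derivative X) (at 0 within {0..1}) \<and> \<gamma> 1 = C')"

definition lc_Log :: "'n::{finite,wellorder} sqmat \<Rightarrow> 'n sqmat \<Rightarrow> 'n sqmat" where
  "lc_Log C = the_inv_into Hol (lc_Exp C)"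

definition lc_group_mean ::
    "nat \<Rightarrow> (nat \<Rightarrow> 'n::{finite,wellorder} sqmat) \<Rightarrow> 'n sqmat \<Rightarrow> bool" where
  "lc_group_mean k Cs Cbar \<longleftrightarrow> Cbar \<in> Cor_plus \<and> (\<Sum>i = 1..k. lc_Log Cbar (Cs i)) = 0"

end

theory Submission
  imports Defs "HOL-Computational_Algebra.Formal_Power_Series"
begin

text \<open>
  The inverse of \<open>\<Theta>\<close> is explicit: it sends \<open>Z\<close> to the Gram matrix of the normalised rows of \<open>Z\<close>.
  Its smooth extension to an injective immersion \<open>chart\<close> of the space of all matrices into itself
  has a differentiable inverse by invariance of domain, so all computations can be done in
  \<open>LT1\<close>.  There the left-invariant fields are \<open>Z \<mapsto> Z A\<close>, the Christoffel map
  on the diagonal is \<open>- u Z\<^sup>-\<^sup>1 u\<close>, and the geodesic equation says that \<open>Z\<^sup>-\<^sup>1 Z'\<close> is constant.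
  As \<open>exp\<close> and \<open>log\<close> are polynomials on nilpotent matrices, they are mutually inverse by the
  corresponding identity of formal power series.  The equation of the group mean is triangular with
  respect to the filtration by subdiagonals, hence uniquely solvable.
\<close>

text \<open>\<open>Cor_plus\<close> has empty interior among all matrices, so derivatives within it
  are determined only on \<open>Hol\<close>, and \<open>lc_connection\<close>, an arbitrary choice,
  is determined only on \<open>Hol\<close> as well. Their values have to be pinned down by curves
  inside \<open>Cor_plus\<close> and by left-invariant fields. Since the geodesic equation evaluates
  the Christoffel map only on pairs of equal vectors, the identity nabla_X X = 0 for left-invariant
  X is all that is needed of the connection once its existence is known. A geodesic comes with a
  second derivative of unknown regularity, so the velocity of the lifted curve must itself be shown
  differentiable before the equation can be read in \<open>LT1\<close>; this is why inversion is
  applied to the tangent map of the chart as well. The symmetry of the second derivative of the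
  chart removes the non-tensorial terms from the Lie bracket.\<close>

lemma bounded_bilinear_matrix_mult [bounded_bilinear]:
  "bounded_bilinear ((**) :: real^'n^'m \<Rightarrow> real^'p^'n \<Rightarrow> real^'p^'m)"
  unfolding bilinear_conv_bounded_bilinear[symmetric] bilinear_def
  by (auto intro!: linearI simp: matrix_matrix_mult_def vec_eq_iff algebra_simps
      sum.distrib sum_distrib_left)

interpretation mm: bounded_bilinear "(**) :: real^'n^'m \<Rightarrow> real^'p^'n \<Rightarrow> real^'p^'m"
  by (rule bounded_bilinear_matrix_mult)

lemma matrix_inv_unique_left:
  fixes A B :: "real^'n^'n"
  assumes "A ** B = mat 1"
  shows "matrix_inv A = B"
proof -
  have BA: "B ** A = mat 1"
    using assms matrix_left_right_inverse by blast
  have "\<exists>A'. A ** A' = mat 1 \<and> A' ** A = mat 1"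
    using assms BA by blast
  then have "matrix_inv A ** A = mat 1"
    unfolding matrix_inv_def by (metis (mono_tags, lifting) someI_ex)
  then show ?thesis
    by (metis assms matrix_mul_assoc matrix_mul_lid matrix_mul_rid)
qed

section \<open>The filtration by subdiagonals\<close>

text \<open>The rank of \<open>i\<close> in the order: the index type carries no arithmetic, and
  subdiagonals are counted by differences of ranks.\<close>

definition idx :: "'n::{finite,wellorder} \<Rightarrow> nat" where
  "idx i = card {..<i}"

lemma idx_less_iff: "idx i < idx j \<longleftrightarrow> i < j"
proof
  assume *: "idx i < idx j"
  show "i < j"
  proof (rule ccontr)
    assume "\<not> i < j"
    then have "idx j \<le> idx i" unfolding idx_def by (intro card_mono) auto
    with * show False by simp
  qed
next
  assume "i < j"
  then show "idx i < idx j" unfolding idx_def by (intro psubset_card_mono) auto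
qed

lemma idx_less_card: "idx (i::'n::{finite,wellorder}) < CARD('n)"
  unfolding idx_def by (intro psubset_card_mono) auto

text \<open>The decreasing filtration of the triangular algebra: \<open>LTs 0\<close> consists of
  the lower triangular matrices, \<open>LTs 1\<close> is \<open>LT0\<close>, and
  \<open>LTs d\<close> is zero once \<open>d\<close> reaches the size. Writing
  \<open>idx j + d\<close> avoids truncated subtraction.\<close>

definition LTs :: "nat \<Rightarrow> 'n::{finite,wellorder} sqmat set" where
  "LTs d = {A. \<forall>i j. idx i < idx j + d \<longrightarrow> A $ i $ j = 0}"

lemma subspace_LTs: "subspace (LTs d)"
  by (auto simp: subspace_def LTs_def)

lemma LT0_eq_LTs: "LT0 = LTs 1"
  unfolding LT0_def LTs_def lower_triangular_def
  by (auto simp: less_Suc_eq idx_less_iff) (metis idx_less_iff linorder_neq_iff)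

lemma subspace_LT0: "subspace LT0"
  unfolding LT0_eq_LTs by (rule subspace_LTs)

lemma lower_triangular_iff_LTs: "lower_triangular A \<longleftrightarrow> A \<in> LTs 0"
  by (auto simp: LTs_def lower_triangular_def idx_less_iff)

lemma LTs_mono: "d \<le> e \<Longrightarrow> A \<in> LTs e \<Longrightarrow> A \<in> LTs d"
  by (auto simp: LTs_def)

text \<open>A nonzero summand at \<open>(i, j)\<close> needs a rank drop of at least
  \<open>d\<close> from \<open>i\<close> to \<open>l\<close> and of at least \<open>e\<close> from
  \<open>l\<close> to \<open>j\<close>. Nilpotency and all perturbation estimates rest on this
  grading.\<close>

lemma LTs_mult:
  fixes A B :: "'n::{finite,wellorder} sqmat"
  assumes "A \<in> LTs d" "B \<in> LTs e"
  shows "A ** B \<in> LTs (d + e)"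
proof -
  have "(\<Sum>l\<in>UNIV. A$i$l * B$l$j) = 0" if "idx i < idx j + (d + e)" for i j :: 'n
  proof (rule sum.neutral, safe)
    fix l :: 'n
    have "idx i < idx l + d \<or> idx l < idx j + e" using that by linarith
    then show "A$i$l * B$l$j = 0" using assms by (auto simp: LTs_def)
  qed
  then show ?thesis by (simp add: LTs_def matrix_matrix_mult_def)
qed

lemma LTs_eq_0: "A \<in> LTs d \<Longrightarrow> CARD('n) \<le> d \<Longrightarrow> A = (0 :: 'n::{finite,wellorder} sqmat)"
proof -
  assume *: "A \<in> LTs d" "CARD('n) \<le> d"
  have "A $ i $ j = 0" for i j
  proof -
    have "idx i < idx j + d" using idx_less_card[of i] *(2) by linarith
    then show ?thesis using *(1) by (simp add: LTs_def)
  qed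
  then show ?thesis by (simp add: vec_eq_iff)
qed

lemma mat1_LTs: "mat 1 \<in> LTs 0"
  by (auto simp: LTs_def mat_def)

lemma mpow_LTs: "A \<in> LT0 \<Longrightarrow> mpow A k \<in> LTs k"
proof (induction k)
  case 0 then show ?case by (simp add: mat1_LTs)
next
  case (Suc k)
  then show ?case using LTs_mult[of A 1 "mpow A k" k] by (simp add: LT0_eq_LTs)
qed

lemma mpow_nilpotent:
  "A \<in> LT0 \<Longrightarrow> CARD('n) \<le> k \<Longrightarrow> mpow (A :: 'n::{finite,wellorder} sqmat) k = 0"
  using mpow_LTs LTs_eq_0 by blast

lemma LT1_iff: "Z \<in> LT1 \<longleftrightarrow> Z - mat 1 \<in> LT0"
proof -
  have "Z = mat 1 + (Z - mat 1)" by simp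
  then show ?thesis unfolding LT1_def by (smt (verit) add_diff_cancel_left' mem_Collect_eq)
qed

lemma mat1_LT1: "mat 1 \<in> LT1"
  by (simp add: LT1_iff subspace_LT0 subspace_0)

lemma LT1_LTs: "Z \<in> LT1 \<Longrightarrow> Z \<in> LTs 0"
  using subspace_add[OF subspace_LTs _ mat1_LTs, of "Z - mat 1"] LTs_mono[of 0 1 "Z - mat 1"]
  by (simp add: LT1_iff LT0_eq_LTs)

lemma LT0_mult_left: "A \<in> LTs 0 \<Longrightarrow> B \<in> LT0 \<Longrightarrow> A ** B \<in> LT0"
  using LTs_mult[of A 0 B 1] by (simp add: LT0_eq_LTs)

lemma LT0_mult_right: "A \<in> LT0 \<Longrightarrow> B \<in> LTs 0 \<Longrightarrow> A ** B \<in> LT0"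
  using LTs_mult[of A 1 B 0] by (simp add: LT0_eq_LTs)

lemma LT1_mult:
  assumes "Z \<in> LT1" "W \<in> LT1" shows "Z ** W \<in> LT1"
proof -
  have "Z ** W - mat 1 = Z ** (W - mat 1) + (Z - mat 1)" by (simp add: mm.diff_right)
  also have "\<dots> \<in> LT0"
    using assms LT0_mult_left[OF LT1_LTs] by (intro subspace_add subspace_LT0) (auto simp: LT1_iff)
  finally show ?thesis by (simp add: LT1_iff)
qed

section \<open>Formal power series evaluated at nilpotent matrices\<close>

lemma mpow_add: "mpow A (i + j) = mpow A i ** mpow A j"
  by (induction i) (simp_all add: matrix_mul_assoc)

text \<open>Truncation at the size costs nothing on \<open>LT0\<close>, where higher powers vanish.
  Every evaluation is then a polynomial, so no question of convergence arises and differentiability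
  is elementary.\<close>

definition fps_mat :: "real fps \<Rightarrow> 'n::{finite,wellorder} sqmat \<Rightarrow> 'n sqmat" where
  "fps_mat F N = (\<Sum>k<CARD('n). fps_nth F k *\<^sub>R mpow N k)"

lemma fps_mat_mult:
  assumes "N \<in> LT0"
  shows "fps_mat (F * G) N = fps_mat F N ** fps_mat G N"
proof -
  let ?n = "CARD('a)"
  let ?g = "\<lambda>i j. (fps_nth F i * fps_nth G j) *\<^sub>R mpow N (i + j)"
  have "fps_mat F N ** fps_mat G N = (\<Sum>i<?n. \<Sum>j<?n. ?g i j)"
    unfolding fps_mat_def mm.sum_left mm.sum_right
    by (simp add: mm.scaleR_left mm.scaleR_right mpow_add mult.commute)
       (rule sum.swap)
  also have "\<dots> = (\<Sum>(i,j)\<in>{..<?n}\<times>{..<?n}. ?g i j)"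
    by (simp add: sum.cartesian_product)
  \<comment> \<open>The square of index pairs shrinks to the triangle: the discarded pairs carry
    powers of \<open>N\<close> with exponent at least the size, which vanish.\<close>
  also have "\<dots> = (\<Sum>(i,j)\<in>{(i,j). i + j < ?n}. ?g i j)"
    by (rule sum.mono_neutral_right) (auto intro!: mpow_nilpotent[OF assms] simp: not_less)
  also have "\<dots> = (\<Sum>k<?n. \<Sum>i\<le>k. ?g i (k - i))"
    by (rule sum.triangle_reindex)
  also have "\<dots> = fps_mat (F * G) N"
    unfolding fps_mat_def by (simp add: fps_mult_nth scaleR_sum_left atLeast0AtMost)
  finally show ?thesis by simp
qed

lemma fps_mat_1: "fps_mat 1 (N :: 'n::{finite,wellorder} sqmat) = mat 1"
proof -
  have "fps_mat 1 N = (\<Sum>k<CARD('n). if k = 0 then mat 1 else 0)"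
    unfolding fps_mat_def by (intro sum.cong) auto
  then show ?thesis by simp
qed

lemma fps_mat_add: "fps_mat (F + G) N = fps_mat F N + fps_mat G N"
  by (simp add: fps_mat_def scaleR_add_left sum.distrib)

lemma fps_mat_diff: "fps_mat (F - G) N = fps_mat F N - fps_mat G N"
  by (simp add: fps_mat_def scaleR_diff_left sum_subtractf)

lemma fps_mat_X:
  assumes "N \<in> LT0"
  shows "fps_mat fps_X N = (N :: 'n::{finite,wellorder} sqmat)"
proof -
  have "fps_mat fps_X N = (\<Sum>k<CARD('n). if k = 1 then N else 0)"
    unfolding fps_mat_def by (intro sum.cong) auto
  \<comment> \<open>In size 1 the truncation drops the linear coefficient, but then
    \<open>LT0\<close> contains only 0.\<close>
  moreover have "N = 0" if "CARD('n) \<le> 1"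
    using assms that LTs_eq_0[of N 1] by (simp add: LT0_eq_LTs)
  ultimately show ?thesis by (cases "CARD('n) \<le> 1") auto
qed

lemma fps_mat_power:
  assumes "N \<in> LT0"
  shows "fps_mat (F ^ m) N = mpow (fps_mat F N) m"
  by (induction m) (simp_all add: fps_mat_1 fps_mat_mult[OF assms])

lemma fps_mat_LT0:
  assumes "N \<in> LT0" "fps_nth F 0 = 0"
  shows "fps_mat F N \<in> LT0"
  unfolding fps_mat_def
proof (intro subspace_sum subspace_LT0)
  fix k
  have "mpow N k \<in> LT0" if "k \<noteq> 0"
    using mpow_LTs[OF assms(1), of k] LTs_mono[of 1 k] that by (simp add: LT0_eq_LTs)
  then show "fps_nth F k *\<^sub>R mpow N k \<in> LT0"
    using assms(2) by (cases "k = 0") (auto intro: subspace_scale subspace_0 subspace_LT0)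
qed

lemma fps_mat_compose:
  assumes "N \<in> LT0" "fps_nth G 0 = 0"
  shows "fps_mat (F oo G) N = fps_mat F (fps_mat G N)"
proof -
  let ?n = "CARD('a)"
  have "fps_mat (F oo G) N
      = (\<Sum>k<?n. \<Sum>i<?n. (fps_nth F i * fps_nth (G^i) k) *\<^sub>R mpow N k)"
    unfolding fps_mat_def
  proof (rule sum.cong[OF refl])
    fix k assume "k \<in> {..<?n}"
    \<comment> \<open>As \<open>G\<close> has no constant term, \<open>G^i\<close> has no
      coefficient of degree below \<open>i\<close>, so \<open>i\<close> may run over a range
      independent of \<open>k\<close>.\<close>
    then have "(\<Sum>i<?n. fps_nth F i * fps_nth (G^i) k) = (\<Sum>i=0..k. fps_nth F i * fps_nth (G^i) k)"
      by (intro sum.mono_neutral_right) (auto simp: startsby_zero_power_prefix[OF assms(2)])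
    then show "fps_nth (F oo G) k *\<^sub>R mpow N k
        = (\<Sum>i<?n. (fps_nth F i * fps_nth (G^i) k) *\<^sub>R mpow N k)"
      by (simp add: fps_compose_nth flip: scaleR_sum_left)
  qed
  also have "\<dots> = (\<Sum>i<?n. fps_nth F i *\<^sub>R fps_mat (G^i) N)"
    by (subst sum.swap) (simp add: fps_mat_def scaleR_sum_right)
  also have "\<dots> = fps_mat F (fps_mat G N)"
    by (simp add: fps_mat_power[OF assms(1)]) (simp add: fps_mat_def)
  finally show ?thesis .
qed

section \<open>Exponential and logarithm as evaluated power series\<close>

lemma mexp_eq_fps_mat:
  assumes "N \<in> LT0"
  shows "mexp (t *\<^sub>R N) = fps_mat (fps_exp t) (N :: 'n::{finite,wellorder} sqmat)"
proof -
  have p: "mpow (t *\<^sub>R N) k = t^k *\<^sub>R mpow N k" for k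
    by (induction k) (simp_all add: mm.scaleR_left mm.scaleR_right)
  have "mexp (t *\<^sub>R N) = (\<Sum>k<CARD('n). (1 / fact k) *\<^sub>R mpow (t *\<^sub>R N) k)"
    unfolding mexp_def by (rule suminf_finite) (auto simp: p mpow_nilpotent[OF assms])
  then show ?thesis by (simp add: fps_mat_def p)
qed

lemma mexp_eq_fps_mat_1: "N \<in> LT0 \<Longrightarrow> mexp N = fps_mat (fps_exp 1) N"
  using mexp_eq_fps_mat[of N 1] by simp

lemma mlog_eq_fps_mat: "mlog Z = fps_mat (fps_ln 1) (Z - mat 1)"
proof -
  have "fps_mat (fps_ln 1) (Z - mat 1)
      = (\<Sum>k\<in>{1..CARD('a)-1}. fps_nth (fps_ln 1) k *\<^sub>R mpow (Z - mat 1) k)"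
    unfolding fps_mat_def by (rule sum.mono_neutral_right) (auto simp: fps_ln_nth Suc_le_eq)
  also have "\<dots> = mlog Z"
    unfolding mlog_def by (rule sum.cong) (auto simp: fps_ln_nth)
  finally show ?thesis by simp
qed

lemma mexp_minus_mat1: "N \<in> LT0 \<Longrightarrow> mexp N - mat 1 = fps_mat (fps_exp 1 - 1) N"
  by (simp add: mexp_eq_fps_mat_1 fps_mat_diff fps_mat_1)

lemma mexp_LT1: "N \<in> LT0 \<Longrightarrow> mexp N \<in> LT1"
  by (simp add: LT1_iff mexp_minus_mat1 fps_mat_LT0)

lemma mlog_LT0: "Z \<in> LT1 \<Longrightarrow> mlog Z \<in> LT0"
  by (simp add: LT1_iff mlog_eq_fps_mat fps_mat_LT0)

text \<open>\<open>fps_ln 1\<close> is the compositional inverse of \<open>fps_exp 1 - 1\<close>,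
  and evaluation on \<open>LT0\<close> respects composition.\<close>

lemma mlog_mexp:
  assumes "N \<in> LT0" shows "mlog (mexp N) = N"
proof -
  have "fps_ln 1 oo (fps_exp 1 - 1) = (fps_X :: real fps)"
    by (simp add: fps_ln_fps_exp_inv fps_inv)
  then show ?thesis
    by (simp add: mlog_eq_fps_mat mexp_minus_mat1[OF assms] fps_mat_X[OF assms]
        flip: fps_mat_compose[OF assms])
qed

lemma mexp_mlog:
  assumes "Z \<in> LT1" shows "mexp (mlog Z) = Z"
proof -
  let ?N = "Z - mat 1"
  have N: "?N \<in> LT0" using assms by (simp add: LT1_iff)
  have "(fps_exp 1 - 1) oo fps_ln 1 = (fps_X :: real fps)"
    by (simp add: fps_ln_fps_exp_inv fps_inv_right)
  then have "mexp (mlog Z) - mat 1 = ?N"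
    by (simp add: mlog_eq_fps_mat mexp_minus_mat1 fps_mat_LT0 N fps_mat_X
        flip: fps_mat_compose[OF N])
  then show ?thesis by simp
qed

lemma mexp_0: "mexp (0 :: 'n::{finite,wellorder} sqmat) = mat 1"
  using mexp_eq_fps_mat[of "0 :: 'n sqmat" 0] by (simp add: subspace_0 subspace_LT0 fps_mat_1)

text \<open>With the parameter kept in the series \<open>fps_exp s\<close> rather than in the
  matrix, the law of one-parameter groups is the power series identity for the exponential of a
  sum.\<close>

lemma mexp_minus:
  assumes "N \<in> LT0"
  shows "mexp (s *\<^sub>R N) ** mexp (- s *\<^sub>R N) = mat 1"
    and "mexp (- s *\<^sub>R N) ** mexp (s *\<^sub>R N) = mat 1"
  unfolding mexp_eq_fps_mat[OF assms] fps_mat_mult[OF assms, symmetric]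
  by (simp_all add: fps_mat_1 flip: fps_exp_add_mult)

lemma mexp_commute:
  assumes "N \<in> LT0"
  shows "N ** mexp (s *\<^sub>R N) = mexp (s *\<^sub>R N) ** N"
  using fps_mat_mult[OF assms, of fps_X "fps_exp s"] fps_mat_mult[OF assms, of "fps_exp s" fps_X]
  by (simp add: mexp_eq_fps_mat[OF assms] fps_mat_X[OF assms] mult.commute)

lemma mexp_has_vector_derivative:
  assumes "N \<in> LT0"
  shows "((\<lambda>s. mexp (s *\<^sub>R N)) has_vector_derivative mexp (s *\<^sub>R N) ** N) (at s within S)"
proof -
  have "((\<lambda>s. fps_mat (fps_exp s) N) has_vector_derivative
      (\<Sum>k<CARD('a). (real k * s ^ (k - 1) / fact k) *\<^sub>R mpow N k)) (at s within S)"
    unfolding fps_mat_def by (auto intro!: derivative_eq_intros has_vector_derivative_scaleR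
        simp: has_real_derivative_iff_has_vector_derivative[symmetric])
  \<comment> \<open>Multiplication by \<open>fps_X\<close> shifts degrees by one, and s^(k-1)/(k-1)!
    equals k s^(k-1)/k!; both sides have constant term 0.\<close>
  moreover have "(\<Sum>k<CARD('a). (real k * s ^ (k - 1) / fact k) *\<^sub>R mpow N k) = fps_mat (fps_exp s * fps_X) N"
    unfolding fps_mat_def
  proof (rule sum.cong[OF refl])
    fix k
    show "(real k * s ^ (k - 1) / fact k) *\<^sub>R mpow N k = fps_nth (fps_exp s * fps_X) k *\<^sub>R mpow N k"
      by (cases k) (auto simp: fact_Suc simp del: of_nat_Suc)
  qed
  ultimately show ?thesis
    by (simp add: mexp_eq_fps_mat[OF assms] fps_mat_mult[OF assms] fps_mat_X[OF assms])
qed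

text \<open>The inverse is the geometric series 1/(1 + X) at the nilpotent part. Its constant
  coefficient 1 keeps it in \<open>LT1\<close>, and its polynomial form makes it depend
  differentiably on \<open>Z\<close>.\<close>

lemma LT1_inverse:
  assumes "Z \<in> LT1"
  shows "matrix_inv Z = fps_mat (inverse (1 + fps_X)) (Z - mat 1)"
    and "Z ** matrix_inv Z = mat 1" and "matrix_inv Z ** Z = mat 1" and "matrix_inv Z \<in> LT1"
proof -
  let ?N = "Z - mat 1"
  let ?F = "inverse (1 + fps_X) :: real fps"
  have N: "?N \<in> LT0" using assms by (simp add: LT1_iff)
  have F: "(1 + fps_X) * ?F = 1" by (metis inverse_mult_eq_1' fps_add_nth fps_one_nth fps_X_nth add_0_right zero_neq_one)
  have "Z ** fps_mat ?F ?N = fps_mat (1 + fps_X) ?N ** fps_mat ?F ?N"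
    by (simp add: fps_mat_add fps_mat_1 fps_mat_X[OF N])
  then have *: "Z ** fps_mat ?F ?N = mat 1"
    by (simp add: F fps_mat_1 flip: fps_mat_mult[OF N])
  then show **: "matrix_inv Z = fps_mat ?F ?N" by (rule matrix_inv_unique_left)
  show "Z ** matrix_inv Z = mat 1" using * ** by simp
  then show "matrix_inv Z ** Z = mat 1" using matrix_left_right_inverse by blast
  have "fps_mat ?F ?N - mat 1 = fps_mat (?F - 1) ?N" by (simp add: fps_mat_diff fps_mat_1)
  also have "\<dots> \<in> LT0" using N by (intro fps_mat_LT0) auto
  finally show "matrix_inv Z \<in> LT1" by (simp add: LT1_iff **)
qed

lemma matrix_inv_cancel:
  assumes "Z \<in> LT1"
  shows "Z ** (matrix_inv Z ** A) = A" "matrix_inv Z ** (Z ** A) = A"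
  using LT1_inverse[OF assms] by (simp_all add: matrix_mul_assoc)

lemma differentiable_mpow: "(\<lambda>Z. mpow Z k) differentiable (at Z within S)"
proof (induction k)
  case (Suc k)
  then show ?case
    using bounded_bilinear.FDERIV[OF bounded_bilinear_matrix_mult has_derivative_ident]
    unfolding differentiable_def by (simp, blast)
qed simp

lemma differentiable_fps_mat: "fps_mat F differentiable (at Z within S)"
proof -
  have "(\<lambda>Z. c *\<^sub>R mpow Z k) differentiable (at Z within S)" for c k
    using differentiable_mpow[of k Z S] has_derivative_scaleR_right
    unfolding differentiable_def by blast
  then have "(\<lambda>Z. fps_mat F Z) differentiable (at Z within S)"
    unfolding fps_mat_def by (intro differentiable_sum) auto
  then show ?thesis by simp
qed

text \<open>The polynomial formula for the inverse yields differentiability; the value of the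
  derivative comes from differentiating \<open>z s ** matrix_inv (z s) = mat 1\<close>.\<close>

lemma matrix_inv_has_vector_derivative:
  assumes "t \<in> J" "at t within J \<noteq> bot"
    and z: "\<And>s. s \<in> J \<Longrightarrow> z s \<in> LT1" "(z has_vector_derivative u) (at t within J)"
  shows "((\<lambda>s. matrix_inv (z s)) has_vector_derivative
           - (matrix_inv (z t) ** u ** matrix_inv (z t))) (at t within J)"
proof -
  let ?F = "inverse (1 + fps_X) :: real fps"
  have "((\<lambda>s. z s - mat 1) has_vector_derivative u) (at t within J)"
    using z(2) by (auto intro!: derivative_eq_intros)
  then have "(\<lambda>s. fps_mat ?F (z s - mat 1)) differentiable (at t within J)"
    using differentiable_chain_within[OF _ differentiable_fps_mat, of "\<lambda>s. z s - mat 1" t J ?F]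
    by (simp add: o_def differentiableI_vector)
  then obtain w where "((\<lambda>s. fps_mat ?F (z s - mat 1)) has_vector_derivative w) (at t within J)"
    using vector_derivative_works by blast
  then have w: "((\<lambda>s. matrix_inv (z s)) has_vector_derivative w) (at t within J)"
    by (rule has_vector_derivative_transform[OF \<open>t \<in> J\<close>, rotated])
       (simp add: LT1_inverse(1) z(1))
  have "((\<lambda>s. z s ** matrix_inv (z s)) has_vector_derivative z t ** w + u ** matrix_inv (z t)) (at t within J)"
    by (rule bounded_bilinear.has_vector_derivative[OF bounded_bilinear_matrix_mult z(2) w])
  moreover have "((\<lambda>s. z s ** matrix_inv (z s)) has_vector_derivative 0) (at t within J)"
    by (rule has_vector_derivative_transform[OF \<open>t \<in> J\<close>, of _ "\<lambda>_. mat 1"])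
       (simp_all add: LT1_inverse(2) z(1))
  ultimately have "z t ** w + u ** matrix_inv (z t) = 0"
    using vector_derivative_unique_within[OF assms(2)] by blast
  then have "matrix_inv (z t) ** (z t ** w) = - (matrix_inv (z t) ** (u ** matrix_inv (z t)))"
    by (metis add_eq_0_iff mm.minus_right minus_equation_iff)
  then have "w = - (matrix_inv (z t) ** u ** matrix_inv (z t))"
    unfolding matrix_inv_cancel(2)[OF z(1)[OF \<open>t \<in> J\<close>]] by (simp add: matrix_mul_assoc)
  then show ?thesis using w by simp
qed

section \<open>Group means of unitriangular matrices\<close>

text \<open>Each word in the expanded difference has a factor \<open>E\<close>, of degree at least
  \<open>d\<close>, and \<open>k\<close> further factors of degree at least 1.\<close>

lemma mpow_perturb:
  assumes "N \<in> LT0" "E \<in> LTs d" "1 \<le> d"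
  shows "mpow (N + E) (Suc k) - mpow N (Suc k) \<in> LTs (d + k)"
proof (induction k)
  case 0 then show ?case using assms by simp
next
  case (Suc k)
  let ?D = "mpow (N + E) (Suc k) - mpow N (Suc k)"
  have "N + E \<in> LTs 1"
    using assms LTs_mono[of 1 d E] by (intro subspace_add subspace_LTs) (auto simp: LT0_eq_LTs)
  then have "(N + E) ** ?D \<in> LTs (d + Suc k)"
    using LTs_mult[OF _ Suc] by force
  moreover have "E ** mpow N (Suc k) \<in> LTs (d + Suc k)"
    using LTs_mult[OF assms(2) mpow_LTs[OF assms(1)]] .
  moreover have "mpow (N + E) (Suc (Suc k)) - mpow N (Suc (Suc k))
      = (N + E) ** ?D + E ** mpow N (Suc k)"
    unfolding mpow.simps(2)[of _ "Suc k"] mm.diff_right mm.add_left by simp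
  ultimately show ?case
    using subspace_add[OF subspace_LTs] by metis
qed

text \<open>Without a linear coefficient only powers from the second on contribute, and these gain a
  degree over \<open>E\<close>.\<close>

lemma fps_mat_perturb:
  assumes "N \<in> LT0" "E \<in> LTs d" "1 \<le> d" "fps_nth F 1 = 0"
  shows "fps_mat F (N + E) - fps_mat F N \<in> LTs (d + 1)"
  unfolding fps_mat_def sum_subtractf[symmetric] scaleR_diff_right[symmetric]
proof (intro subspace_sum subspace_LTs)
  fix k
  show "fps_nth F k *\<^sub>R (mpow (N + E) k - mpow N k) \<in> LTs (d + 1)"
  proof (cases "k \<le> 1")
    case True
    then show ?thesis using assms(4) by (cases k) (auto simp: subspace_0 subspace_LTs)
  next
    case False
    then obtain l where "k = Suc l" "1 \<le> l" by (cases k) auto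
    then show ?thesis
      using LTs_mono[OF _ mpow_perturb[OF assms(1-3), of l], of "d + 1"]
      by (auto intro: subspace_scale subspace_LTs)
  qed
qed

text \<open>The linear coefficient of the logarithm is 1, so subtracting \<open>fps_X\<close> leaves
  a series to which \<open>fps_mat_perturb\<close> applies.\<close>

lemma mlog_perturb:
  assumes "W \<in> LT1" "E \<in> LTs d" "1 \<le> d"
  shows "mlog (W + E) - mlog W - E \<in> LTs (d + 1)"
proof -
  let ?N = "W - mat 1"
  have N: "?N \<in> LT0" using assms(1) by (simp add: LT1_iff)
  have E: "E \<in> LT0" using assms LTs_mono[of 1 d E] by (simp add: LT0_eq_LTs)
  have NE: "?N + E \<in> LT0" using N E subspace_add subspace_LT0 by blast
  have "mlog (W + E) - mlog W - E = fps_mat (fps_ln 1 - fps_X) (?N + E) - fps_mat (fps_ln 1 - fps_X) ?N"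
    unfolding mlog_eq_fps_mat fps_mat_diff fps_mat_X[OF N] fps_mat_X[OF NE]
    by (simp add: diff_add_eq)
  then show ?thesis
    using fps_mat_perturb[OF N assms(2,3)] by (simp add: fps_ln_nth)
qed

lemma LT1_add:
  assumes "Z \<in> LT1" "E \<in> LTs d" "1 \<le> d" shows "Z + E \<in> LT1"
proof -
  have "(Z - mat 1) + E \<in> LT0"
    using assms LTs_mono[of 1 d E] unfolding LT1_iff LT0_eq_LTs
    by (intro subspace_add[OF subspace_LTs])
  then show ?thesis by (simp add: LT1_iff diff_add_eq)
qed

text \<open>In \<open>?A - ?B = - (?A ** E ** ?B)\<close> the factors \<open>?A\<close> and
  \<open>?B ** Y\<close> around \<open>E\<close> are the identity modulo \<open>LTs 1\<close>, so to
  leading order the quotient moves by \<open>- E\<close>.\<close>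

lemma matrix_inv_perturb:
  assumes "Z \<in> LT1" "E \<in> LTs d" "1 \<le> d" "Y \<in> LT1"
  shows "matrix_inv (Z + E) ** Y - matrix_inv Z ** Y + E \<in> LTs (d + 1)"
proof -
  let ?A = "matrix_inv (Z + E)" and ?B = "matrix_inv Z"
  have ZE: "Z + E \<in> LT1" using LT1_add assms by blast
  have "?A ** (Z + E) ** ?B = ?B" "?A ** Z ** ?B = ?A"
    using LT1_inverse[OF ZE] LT1_inverse[OF assms(1)] by (simp_all flip: matrix_mul_assoc)
  then have AB: "?A - ?B = - (?A ** E ** ?B)"
    by (simp add: mm.add_left mm.add_right algebra_simps)
  have "?A ** Y - ?B ** Y = - (?A ** E ** (?B ** Y))"
    using AB by (simp add: matrix_mul_assoc flip: mm.diff_left mm.minus_left)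
  then have "?A ** Y - ?B ** Y + E = - ((?A - mat 1) ** (E ** (?B ** Y)) + E ** (?B ** Y - mat 1))"
    by (simp add: mm.diff_left mm.diff_right matrix_mul_assoc)
  also have "\<dots> \<in> LTs (d + 1)"
  proof (intro subspace_neg subspace_add subspace_LTs)
    have A: "?A - mat 1 \<in> LTs 1" and BY: "?B ** Y \<in> LT1"
      using LT1_inverse(4) LT1_mult ZE assms(1,4) by (auto simp: LT1_iff LT0_eq_LTs)
    show "(?A - mat 1) ** (E ** (?B ** Y)) \<in> LTs (d + 1)"
      using LTs_mult[OF A LTs_mult[OF assms(2) LT1_LTs[OF BY]]] by (simp add: add.commute)
    have "?B ** Y - mat 1 \<in> LTs 1" using BY by (simp add: LT1_iff LT0_eq_LTs)
    then show "E ** (?B ** Y - mat 1) \<in> LTs (d + 1)" by (rule LTs_mult[OF assms(2)])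
  qed
  finally show ?thesis .
qed

lemma mlog_sum_perturb:
  fixes Y :: "nat \<Rightarrow> 'n::{finite,wellorder} sqmat" and k :: nat
  defines "F \<equiv> \<lambda>Z. \<Sum>i = 1..k. mlog (matrix_inv Z ** Y i)"
  assumes "Z \<in> LT1" "E \<in> LTs d" "1 \<le> d" "\<And>i. i \<in> {1..k} \<Longrightarrow> Y i \<in> LT1"
  shows "F (Z + E) - F Z + real k *\<^sub>R E \<in> LTs (d + 1)"
proof -
  have "F (Z + E) - F Z + real k *\<^sub>R E
      = (\<Sum>i = 1..k. mlog (matrix_inv (Z + E) ** Y i) - mlog (matrix_inv Z ** Y i) + E)"
    by (simp add: F_def sum.distrib sum_subtractf scaleR_conv_of_real sum_constant_scaleR)
  also have "\<dots> \<in> LTs (d + 1)"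
  proof (intro subspace_sum subspace_LTs)
    fix i assume i: "i \<in> {1..k}"
    let ?W = "matrix_inv Z ** Y i"
    \<comment> \<open>The true increment of the quotient. It equals \<open>- E\<close> only modulo
      \<open>LTs (d + 1)\<close>, which still places it in \<open>LTs d\<close>, as
      \<open>mlog_perturb\<close> requires.\<close>
    define D where "D = matrix_inv (Z + E) ** Y i - ?W"
    have W: "?W \<in> LT1" using assms(2,5) i LT1_mult LT1_inverse(4) by blast
    have DE: "D + E \<in> LTs (d + 1)"
      unfolding D_def using matrix_inv_perturb assms(2-5) i by blast
    have "D + E - E \<in> LTs d"
      using LTs_mono[OF _ DE, of d] assms(3) by (intro subspace_diff subspace_LTs) auto
    then have "mlog (?W + D) - mlog ?W - D \<in> LTs (d + 1)"
      using mlog_perturb[OF W _ assms(4)] by simp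
    from subspace_add[OF subspace_LTs this DE]
    show "mlog (matrix_inv (Z + E) ** Y i) - mlog ?W + E \<in> LTs (d + 1)"
      by (simp add: D_def algebra_simps)
  qed
  finally show ?thesis .
qed

text \<open>Perturbing \<open>Z\<close> by \<open>E\<close> on and below the \<open>d\<close>-th subdiagonal changes the sum of logarithms on
  that subdiagonal by exactly \<open>-k E\<close>, so the equation can be solved one subdiagonal at a time.\<close>

lemma ex1_mlog_sum_eq_0:
  fixes Y :: "nat \<Rightarrow> 'n::{finite,wellorder} sqmat"
  assumes "1 \<le> k" and Y: "\<And>i. i \<in> {1..k} \<Longrightarrow> Y i \<in> LT1"
  shows "\<exists>!Z. Z \<in> LT1 \<and> (\<Sum>i = 1..k. mlog (matrix_inv Z ** Y i)) = 0"
proof -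
  define F where "F Z = (\<Sum>i = 1..k. mlog (matrix_inv Z ** Y i))" for Z
  have F: "F (Z + E) - F Z + real k *\<^sub>R E \<in> LTs (d + 1)"
    if "Z \<in> LT1" "E \<in> LTs d" "1 \<le> d" for Z E d
    unfolding F_def using mlog_sum_perturb that Y by blast
  have F_LTs: "F Z \<in> LTs 1" if "Z \<in> LT1" for Z
    unfolding F_def LT0_eq_LTs[symmetric]
    using that Y by (intro subspace_sum subspace_LT0 mlog_LT0 LT1_mult LT1_inverse(4))
  have "\<exists>Z\<in>LT1. F Z \<in> LTs (Suc d)" for d
  proof (induction d)
    case 0 then show ?case using F_LTs mat1_LT1 by auto
  next
    case (Suc d)
    then obtain Z where Z: "Z \<in> LT1" "F Z \<in> LTs (Suc d)" by blast
    \<comment> \<open>Chosen so that \<open>real k\<close> times \<open>?E\<close> is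
      \<open>F Z\<close>, which cancels the lowest remaining subdiagonal of
      \<open>F Z\<close>.\<close>
    let ?E = "(1 / real k) *\<^sub>R F Z"
    have E: "?E \<in> LTs (Suc d)" using Z by (intro subspace_scale subspace_LTs)
    have "F (Z + ?E) \<in> LTs (Suc (Suc d))"
      using F[OF Z(1) E] assms(1) by simp
    then show ?case using LT1_add[OF Z(1) E] by auto
  qed
  from this[of "CARD('n)"] obtain Z where "Z \<in> LT1" "F Z = 0"
    using LTs_eq_0 by (metis le_SucI order_refl)
  moreover have "Z1 = Z2" if Z: "Z1 \<in> LT1" "F Z1 = 0" "Z2 \<in> LT1" "F Z2 = 0" for Z1 Z2
  proof -
    \<comment> \<open>For \<open>E = Z2 - Z1\<close> both values of \<open>F\<close> vanish, which
      leaves \<open>k\<close> times the difference in the next step of the filtration.\<close>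
    have "Z2 - Z1 \<in> LTs (Suc d)" for d
    proof (induction d)
      case 0
      have "(Z2 - mat 1) - (Z1 - mat 1) \<in> LT0"
        using Z subspace_diff[OF subspace_LT0] by (simp only: LT1_iff)
      then show ?case by (simp add: LT0_eq_LTs)
    next
      case (Suc d)
      then have "real k *\<^sub>R (Z2 - Z1) \<in> LTs (Suc (Suc d))"
        using F[OF Z(1) Suc] Z by simp
      then have "(1 / real k) *\<^sub>R real k *\<^sub>R (Z2 - Z1) \<in> LTs (Suc (Suc d))"
        by (rule subspace_scale[OF subspace_LTs])
      then show ?case using assms(1) by simp
    qed
    from this[of "CARD('n)"] show ?thesis
      using LTs_eq_0 by (metis eq_iff_diff_eq_0 le_SucI order_refl)
  qed
  ultimately show ?thesis unfolding F_def[symmetric] by blast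
qed

section \<open>Twice differentiable maps and their inverses\<close>

text \<open>Global injectivity and invariance of domain give an open range and a continuous inverse,
  taking the place of the inverse function theorem. The derivatives are invertible because they are
  injective endomorphisms of a finite-dimensional space.\<close>

lemma inv_has_derivative:
  fixes f :: "'a::euclidean_space \<Rightarrow> 'a"
  assumes "inj f" and f': "\<And>x. (f has_derivative f' x) (at x)" and inj: "\<And>x. inj (f' x)"
  shows "(inv f has_derivative inv (f' x)) (at (f x))"
proof (rule has_derivative_inverse_basic[where f = f and f' = "f' x" and T = "range f"])
  have cont: "continuous_on UNIV f"
    using f' by (meson continuous_on_eq_continuous_at has_derivative_continuous open_UNIV)
  show open_f: "open (range f)"
    using invariance_of_domain[OF cont open_UNIV] assms(1) by simp
  have "continuous_on (range f) (inv f)"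
    by (rule continuous_on_inverse_open[OF open_UNIV cont]) (auto simp: assms(1))
  then show "continuous (at (f x)) (inv f)"
    using open_f continuous_on_eq_continuous_at by blast
  show "(f has_derivative f' x) (at (inv f (f x)))" using assms by simp
  have lin: "linear (f' x)" using f' has_derivative_linear by blast
  then have "linear (inv (f' x))"
    by (metis inj inj_linear_imp_inv_linear linear_injective_imp_surjective)
  then show "bounded_linear (inv (f' x))" by (simp add: linear_conv_bounded_linear)
  show "inv (f' x) \<circ> f' x = id" using inj by simp
  show "f (inv f z) = z" if "z \<in> range f" for z using that by (simp add: f_inv_into_f)
qed auto

text \<open>Symmetry of the second derivative is built into the notion, as each construction used
  for the chart inherits it. In \<open>f'' x k h\<close> the vector \<open>k\<close> is the
  direction of differentiation and \<open>h\<close> the fixed argument of the first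
  derivative.\<close>

definition twice_diff :: "('a::real_normed_vector \<Rightarrow> 'b::real_normed_vector) \<Rightarrow> bool" where
  "twice_diff f \<longleftrightarrow> (\<exists>f' f''. (\<forall>x. (f has_derivative f' x) (at x)) \<and>
     (\<forall>x h. ((\<lambda>x. f' x h) has_derivative (\<lambda>k. f'' x k h)) (at x)) \<and>
     (\<forall>x h k. f'' x h k = f'' x k h))"

lemma twice_diffI:
  assumes "\<And>x. (f has_derivative f' x) (at x)"
    and "\<And>x h. ((\<lambda>x. f' x h) has_derivative (\<lambda>k. f'' x k h)) (at x)"
    and "\<And>x h k. f'' x h k = f'' x k h"
  shows "twice_diff f"
  unfolding twice_diff_def using assms by blast

lemma twice_diff_const: "twice_diff (\<lambda>x. c)"
  by (rule twice_diffI[where f' = "\<lambda>x h. 0" and f'' = "\<lambda>x k h. 0"]) auto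

lemma twice_diff_bounded_linear: "bounded_linear f \<Longrightarrow> twice_diff f"
  by (rule twice_diffI[where f' = "\<lambda>x. f" and f'' = "\<lambda>x k h. 0"])
     (auto intro: bounded_linear_imp_has_derivative)

lemma twice_diff_add:
  assumes "twice_diff f" "twice_diff g"
  shows "twice_diff (\<lambda>x. f x + g x)"
proof -
  obtain f' f'' where f: "\<And>x. (f has_derivative f' x) (at x)"
    "\<And>x h. ((\<lambda>x. f' x h) has_derivative (\<lambda>k. f'' x k h)) (at x)"
    "\<And>x h k. f'' x h k = f'' x k h"
    using assms(1) unfolding twice_diff_def by blast
  obtain g' g'' where g: "\<And>x. (g has_derivative g' x) (at x)"
    "\<And>x h. ((\<lambda>x. g' x h) has_derivative (\<lambda>k. g'' x k h)) (at x)"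
    "\<And>x h k. g'' x h k = g'' x k h"
    using assms(2) unfolding twice_diff_def by blast
  show ?thesis
    by (rule twice_diffI[where f' = "\<lambda>x h. f' x h + g' x h"
          and f'' = "\<lambda>x k h. f'' x k h + g'' x k h"])
       (use f(1,2) g(1,2) f(3) g(3) in \<open>auto intro: has_derivative_add\<close>)
qed

lemma twice_diff_sum:
  assumes "\<And>i. i \<in> I \<Longrightarrow> twice_diff (f i)"
  shows "twice_diff (\<lambda>x. \<Sum>i\<in>I. f i x)"
  using assms
  by (induction I rule: infinite_finite_induct) (auto intro: twice_diff_const twice_diff_add)

lemma twice_diff_linear_compose:
  assumes "bounded_linear L" "twice_diff f"
  shows "twice_diff (\<lambda>x. L (f x))"
proof -
  obtain f' f'' where f: "\<And>x. (f has_derivative f' x) (at x)"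
    "\<And>x h. ((\<lambda>x. f' x h) has_derivative (\<lambda>k. f'' x k h)) (at x)"
    "\<And>x h k. f'' x h k = f'' x k h"
    using assms(2) unfolding twice_diff_def by blast
  show ?thesis
    by (rule twice_diffI[where f' = "\<lambda>x h. L (f' x h)" and f'' = "\<lambda>x k h. L (f'' x k h)"])
       (use f(1,2) f(3) in \<open>auto intro: bounded_linear.has_derivative[OF assms(1)]\<close>)
qed

lemma twice_diff_bilinear:
  assumes "bounded_bilinear B" "twice_diff f" "twice_diff g"
  shows "twice_diff (\<lambda>x. B (f x) (g x))"
proof -
  obtain f' f'' where f: "\<And>x. (f has_derivative f' x) (at x)"
    "\<And>x h. ((\<lambda>x. f' x h) has_derivative (\<lambda>k. f'' x k h)) (at x)"
    "\<And>x h k. f'' x h k = f'' x k h"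
    using assms(2) unfolding twice_diff_def by blast
  obtain g' g'' where g: "\<And>x. (g has_derivative g' x) (at x)"
    "\<And>x h. ((\<lambda>x. g' x h) has_derivative (\<lambda>k. g'' x k h)) (at x)"
    "\<And>x h k. g'' x h k = g'' x k h"
    using assms(3) unfolding twice_diff_def by blast
  note B = bounded_bilinear.FDERIV[OF assms(1)]
  show ?thesis
  proof (rule twice_diffI[where f' = "\<lambda>x h. B (f x) (g' x h) + B (f' x h) (g x)"
        and f'' = "\<lambda>x k h. (B (f x) (g'' x k h) + B (f' x k) (g' x h)) +
           (B (f' x h) (g' x k) + B (f'' x k h) (g x))"])
    show "((\<lambda>x. B (f x) (g x)) has_derivative (\<lambda>h. B (f x) (g' x h) + B (f' x h) (g x))) (at x)" for x
      by (rule B[OF f(1) g(1)])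
    show "((\<lambda>x. B (f x) (g' x h) + B (f' x h) (g x)) has_derivative
        (\<lambda>k. (B (f x) (g'' x k h) + B (f' x k) (g' x h)) +
           (B (f' x h) (g' x k) + B (f'' x k h) (g x)))) (at x)" for x h
      by (intro has_derivative_add B f g)
  qed (simp add: f(3) g(3))
qed

text \<open>The derivatives of \<open>\<phi>\<close> are required only at values of
  \<open>f\<close>, so that a negative power can be composed with a positive function.\<close>

lemma twice_diff_real_compose:
  fixes f :: "'a::real_normed_vector \<Rightarrow> real"
  assumes "twice_diff f"
    and "\<And>x. (\<phi> has_real_derivative \<phi>' (f x)) (at (f x))"
    and "\<And>x. (\<phi>' has_real_derivative \<phi>'' (f x)) (at (f x))"
  shows "twice_diff (\<lambda>x. \<phi> (f x))"
proof -
  obtain f' f'' where f: "\<And>x. (f has_derivative f' x) (at x)"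
    "\<And>x h. ((\<lambda>x. f' x h) has_derivative (\<lambda>k. f'' x k h)) (at x)"
    "\<And>x h k. f'' x h k = f'' x k h"
    using assms(1) unfolding twice_diff_def by blast
  have c: "((\<lambda>x. \<phi> (f x)) has_derivative (\<lambda>h. \<phi>' (f x) * f' x h)) (at x)"
    "((\<lambda>x. \<phi>' (f x)) has_derivative (\<lambda>h. \<phi>'' (f x) * f' x h)) (at x)" for x
    using has_derivative_compose[OF f(1) assms(2)[unfolded has_field_derivative_def]]
      has_derivative_compose[OF f(1) assms(3)[unfolded has_field_derivative_def]] by auto
  show ?thesis
  proof (rule twice_diffI[where f' = "\<lambda>x h. \<phi>' (f x) * f' x h"
        and f'' = "\<lambda>x k h. \<phi>' (f x) * f'' x k h + \<phi>'' (f x) * f' x k * f' x h"])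
    show "((\<lambda>x. \<phi>' (f x) * f' x h) has_derivative
        (\<lambda>k. \<phi>' (f x) * f'' x k h + \<phi>'' (f x) * f' x k * f' x h)) (at x)" for x h
      by (rule has_derivative_mult[OF c(2) f(2)])
  qed (simp_all add: f(3) c)
qed

section \<open>Canonical first and second derivatives, and their chain rules along curves\<close>

abbreviation D1 :: "('a::real_normed_vector \<Rightarrow> 'b::real_normed_vector) \<Rightarrow> 'a \<Rightarrow> 'a \<Rightarrow> 'b" where
  "D1 f x \<equiv> frechet_derivative f (at x)"

definition D2 :: "('a::real_normed_vector \<Rightarrow> 'b::real_normed_vector) \<Rightarrow> 'a \<Rightarrow> 'a \<Rightarrow> 'a \<Rightarrow> 'b" where
  "D2 f x k h = D1 (\<lambda>x. D1 f x h) x k"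

lemma
  assumes "twice_diff f"
  shows twice_diff_D1: "(f has_derivative D1 f x) (at x)"
    and twice_diff_D2: "((\<lambda>x. D1 f x h) has_derivative (\<lambda>k. D2 f x k h)) (at x)"
    and D2_sym: "D2 f x k h = D2 f x h k"
proof -
  obtain f' f'' where f: "\<And>x. (f has_derivative f' x) (at x)"
    "\<And>x h. ((\<lambda>x. f' x h) has_derivative (\<lambda>k. f'' x k h)) (at x)"
    "\<And>x h k. f'' x h k = f'' x k h"
    using assms unfolding twice_diff_def by blast
  have 1: "D1 f x = f' x" for x
    by (rule frechet_derivative_at[OF f(1), symmetric])
  have 2: "D2 f x k h = f'' x k h" for x k h
    unfolding D2_def 1 using fun_cong[OF frechet_derivative_at[OF f(2)[of h x]], of k] by simp
  show "(f has_derivative D1 f x) (at x)" "((\<lambda>x. D1 f x h) has_derivative (\<lambda>k. D2 f x k h)) (at x)"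
    "D2 f x k h = D2 f x h k"
    unfolding 1 2 by (rule f)+
qed

lemma linear_D1: "twice_diff f \<Longrightarrow> linear (D1 f x)"
  using twice_diff_D1 has_derivative_linear by blast

lemma linear_D2: 
  assumes "twice_diff f" shows "linear (\<lambda>k. D2 f x k h)" "linear (D2 f x k)"
proof -
  show *: "linear (\<lambda>k. D2 f x k h)" for h
    using twice_diff_D2[OF assms] has_derivative_linear by blast
  have "D2 f x k = (\<lambda>h. D2 f x h k)" using D2_sym[OF assms] by blast
  then show "linear (D2 f x k)" using * by simp
qed

text \<open>\<open>twice_diff\<close> differentiates \<open>D1 f x h\<close> for fixed
  \<open>h\<close> only; linearity in \<open>h\<close> and a finite basis reduce the dependence on
  the pair to finitely many fixed vectors.\<close>

lemma D1_has_derivative_joint: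
  fixes f :: "'a::euclidean_space \<Rightarrow> 'b::real_normed_vector"
  assumes f: "twice_diff f"
  shows "((\<lambda>p. D1 f (fst p) (snd p)) has_derivative
           (\<lambda>q. D2 f x (fst q) h + D1 f x (snd q))) (at (x, h))"
proof -
  have expand: "L h = (\<Sum>b\<in>Basis. (h \<bullet> b) *\<^sub>R L b)" if "linear L" for L :: "'a \<Rightarrow> 'b" and h
  proof -
    have "L (\<Sum>b\<in>Basis. (h \<bullet> b) *\<^sub>R b) = (\<Sum>b\<in>Basis. (h \<bullet> b) *\<^sub>R L b)"
      using that by (simp add: linear_sum linear_scale)
    then show ?thesis by (simp add: euclidean_representation)
  qed
  have D: "((\<lambda>p. D1 f (fst p) b) has_derivative (\<lambda>q. D2 f x (fst q) b)) (at (x, h))" for b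
    using has_derivative_compose[OF has_derivative_fst[OF has_derivative_ident], of "\<lambda>x. D1 f x b"]
      twice_diff_D2[OF f] by fastforce
  have "((\<lambda>p. \<Sum>b\<in>Basis. (snd p \<bullet> b) *\<^sub>R D1 f (fst p) b) has_derivative
      (\<lambda>q. \<Sum>b\<in>Basis. (h \<bullet> b) *\<^sub>R D2 f x (fst q) b + (snd q \<bullet> b) *\<^sub>R D1 f x b)) (at (x, h))"
    using D by (auto intro!: derivative_eq_intros)
  then show ?thesis
    by (simp add: sum.distrib flip: expand[OF linear_D1[OF f]] expand[OF linear_D2(2)[OF f]])
qed

lemma D1_has_vector_derivative:
  fixes f :: "'a::euclidean_space \<Rightarrow> 'b::real_normed_vector"
  assumes f: "twice_diff f" and "(z has_vector_derivative u) (at t within J)"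
    and "(w has_vector_derivative w') (at t within J)"
  shows "((\<lambda>s. D1 f (z s) (w s)) has_vector_derivative D2 f (z t) u (w t) + D1 f (z t) w')
           (at t within J)"
proof -
  have "((\<lambda>s. (z s, w s)) has_vector_derivative (u, w')) (at t within J)"
    using assms(2,3) by (rule has_vector_derivative_Pair)
  from vector_derivative_diff_chain_within[OF this has_derivative_at_withinI[OF D1_has_derivative_joint[OF f]]]
  show ?thesis by (simp add: o_def)
qed

lemma twice_diff_has_vector_derivative:
  assumes f: "twice_diff f" and "(z has_vector_derivative u) (at t within J)"
  shows "((\<lambda>s. f (z s)) has_vector_derivative D1 f (z t) u) (at t within J)"
  using vector_derivative_diff_chain_within[OF assms(2) has_derivative_at_withinI[OF twice_diff_D1[OF f]]]
  by (simp add: o_def)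

text \<open>The second part is the first one applied to the tangent map \<open>(x, h) \<mapsto> (f x, D1 f x h)\<close>.\<close>

lemma
  fixes f :: "'a::euclidean_space \<Rightarrow> 'a"
  assumes f: "twice_diff f" and "inj f" and inj: "\<And>x. inj (D1 f x)"
    and "t \<in> J"
    and v: "((\<lambda>s. f (z s)) has_vector_derivative D1 f (z t) (u t)) (at t within J)"
  shows lift_curve: "(z has_vector_derivative u t) (at t within J)"
    and lift_velocity: "((\<lambda>s. D1 f (z s) (u s)) has_vector_derivative a) (at t within J) \<Longrightarrow>
      \<exists>w. (u has_vector_derivative w) (at t within J)"
proof -
  have "((\<lambda>s. inv f (f (z s))) has_vector_derivative inv (D1 f (z t)) (D1 f (z t) (u t))) (at t within J)"
    using vector_derivative_diff_chain_within[OF v has_derivative_at_withinI[OF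
          inv_has_derivative[OF assms(2) twice_diff_D1[OF f] inj]]]
    by (simp add: o_def)
  then show "(z has_vector_derivative u t) (at t within J)"
    using assms(2) inj by simp
  assume a: "((\<lambda>s. D1 f (z s) (u s)) has_vector_derivative a) (at t within J)"
  define T where "T p = (f (fst p), D1 f (fst p) (snd p))" for p
  define T' where "T' p q = (D1 f (fst p) (fst q), D2 f (fst p) (fst q) (snd p) + D1 f (fst p) (snd q))" for p q
  have "inj T"
    by (auto simp: T_def inj_def dest!: injD[OF assms(2)] injD[OF inj])
  moreover have "(T has_derivative T' p) (at p)" for p
    unfolding T_def T'_def
    using D1_has_derivative_joint[OF f, of "fst p" "snd p"]
      has_derivative_compose[OF has_derivative_fst[OF has_derivative_ident], of f "D1 f (fst p)" p UNIV] twice_diff_D1[OF f]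
    by (intro has_derivative_Pair) auto
  \<comment> \<open>\<open>T' p\<close> is block triangular with \<open>D1 f (fst p)\<close> in both
    diagonal blocks.\<close>
  moreover have "inj (T' p)" for p
    by (auto simp: T'_def inj_def dest!: injD[OF inj])
  ultimately have "(inv T has_derivative inv (T' p)) (at (T p))" for p
    by (rule inv_has_derivative)
  moreover have "((\<lambda>s. T (z s, u s)) has_vector_derivative (D1 f (z t) (u t), a)) (at t within J)"
    unfolding T_def using v a by (auto intro: has_vector_derivative_Pair)
  ultimately obtain q where "((\<lambda>s. inv T (T (z s, u s))) has_vector_derivative q) (at t within J)"
    using vector_derivative_diff_chain_within has_derivative_at_withinI unfolding o_def by blast
  then have "((\<lambda>s. (z s, u s)) has_vector_derivative q) (at t within J)"
    using \<open>inj T\<close> by simp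
  from bounded_linear.has_vector_derivative[OF bounded_linear_snd this]
  show "\<exists>w. (u has_vector_derivative w) (at t within J)" by auto
qed

section \<open>Cholesky factors\<close>

lemma mult_diag_LTs0:
  assumes "A \<in> LTs 0" "B \<in> LTs 0"
  shows "(A ** B) $ i $ i = A $ i $ i * B $ i $ i"
proof -
  have "A $ i $ l * B $ l $ i = 0" if "l \<noteq> i" for l
    using assms that by (cases "i < l") (auto simp: LTs_def idx_less_iff not_less)
  then have "(\<Sum>l\<in>UNIV. A $ i $ l * B $ l $ i) = (\<Sum>l\<in>{i}. A $ i $ l * B $ l $ i)"
    by (intro sum.mono_neutral_right) auto
  then show ?thesis by (simp add: matrix_matrix_mult_def)
qed

definition diagm :: "('n::finite \<Rightarrow> real) \<Rightarrow> real^'n^'n" where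
  "diagm d = (\<chi> i j. if i = j then d i else 0)"

lemma diagm_mult_left: "(diagm d ** A) $ i $ j = d i * A $ i $ j"
  by (simp add: diagm_def matrix_matrix_mult_def if_distrib[of "\<lambda>x. x * _"] cong: if_cong)

lemma diagm_mult_right: "(A ** diagm d) $ i $ j = A $ i $ j * d j"
  by (simp add: diagm_def matrix_matrix_mult_def if_distrib[of "\<lambda>x. _ * x"] cong: if_cong)

lemma diagm_mult: "diagm d ** diagm e = diagm (\<lambda>i. d i * e i)"
  by (simp add: vec_eq_iff diagm_mult_left) (simp add: diagm_def)

lemma diagm_inverse: "(\<And>i. d i \<noteq> 0) \<Longrightarrow> diagm d ** diagm (\<lambda>i. inverse (d i)) = mat 1"
  by (simp add: diagm_mult) (simp add: diagm_def mat_def)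

lemma transpose_diagm: "transpose (diagm d) = diagm d"
  by (auto simp: diagm_def transpose_def vec_eq_iff)

lemma diagm_LTs0: "diagm d \<in> LTs 0"
  by (auto simp: diagm_def LTs_def)

lemma LT1_diag: "Z \<in> LT1 \<Longrightarrow> Z $ i $ i = 1"
  by (auto simp: LT1_def LT0_def mat_def)

lemma lower_triangular_factor:
  fixes L :: "'n::{finite,wellorder} sqmat"
  assumes "L \<in> LTs 0" "\<And>i. L $ i $ i \<noteq> 0"
  obtains Z where "Z \<in> LT1" "L = diagm (\<lambda>i. L $ i $ i) ** Z"
proof
  let ?D = "diagm (\<lambda>i. L $ i $ i)" and ?E = "diagm (\<lambda>i. inverse (L $ i $ i))"
  show "L = ?D ** (?E ** L)"
    using diagm_inverse[of "\<lambda>i. L $ i $ i"] assms(2) by (simp add: matrix_mul_assoc)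
  show "?E ** L \<in> LT1"
    using assms by (auto simp: LT1_iff LT0_def lower_triangular_def diagm_mult_left mat_def
        LTs_def idx_less_iff)
qed

lemma LTs0_inverse:
  fixes L :: "'n::{finite,wellorder} sqmat"
  assumes "L \<in> LTs 0" "\<And>i. L $ i $ i \<noteq> 0"
  obtains K where "K \<in> LTs 0" "L ** K = mat 1" "K ** L = mat 1"
proof -
  let ?E = "diagm (\<lambda>i. inverse (L $ i $ i))"
  obtain Z where Z: "Z \<in> LT1" "L = diagm (\<lambda>i. L $ i $ i) ** Z"
    using lower_triangular_factor[OF assms] by blast
  have "L ** (matrix_inv Z ** ?E) = diagm (\<lambda>i. L $ i $ i) ** (Z ** matrix_inv Z) ** ?E"
    by (subst Z(2)) (simp add: matrix_mul_assoc)
  also have "\<dots> = mat 1"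
    using diagm_inverse[of "\<lambda>i. L $ i $ i"] assms(2) by (simp add: LT1_inverse(2)[OF Z(1)])
  finally have LK: "L ** (matrix_inv Z ** ?E) = mat 1" .
  moreover have "(matrix_inv Z ** ?E) ** L = mat 1"
    using LK matrix_left_right_inverse by blast
  moreover have "matrix_inv Z ** ?E \<in> LTs 0"
    using LTs_mult[OF LT1_LTs[OF LT1_inverse(4)[OF Z(1)]] diagm_LTs0] by simp
  ultimately show ?thesis using that by blast
qed

text \<open>The transpose is the inverse and hence lower triangular too, so \<open>A\<close> is
  diagonal; its diagonal entries are positive with square 1.\<close>

lemma lower_orthogonal_eq_mat1:
  fixes A :: "'n::{finite,wellorder} sqmat"
  assumes "A \<in> LTs 0" "\<And>i. A $ i $ i > 0" "A ** transpose A = mat 1"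
  shows "A = mat 1"
proof -
  have "A $ i $ i \<noteq> 0" for i using assms(2)[of i] by simp
  then obtain K where K: "K \<in> LTs 0" "A ** K = mat 1" "K ** A = mat 1"
    using LTs0_inverse[OF assms(1)] by blast
  have AT: "transpose A \<in> LTs 0"
    using K assms(3) by (metis matrix_mul_assoc matrix_mul_lid matrix_mul_rid)
  have "A $ i $ j = 0" if "i \<noteq> j" for i j
    using AT assms(1) that by (cases "i < j") (auto simp: LTs_def transpose_def idx_less_iff)
  moreover have "A $ i $ i = 1" for i
  proof -
    have "A $ i $ i * A $ i $ i = 1"
      using mult_diag_LTs0[OF assms(1) AT, of i] unfolding assms(3) by (simp add: mat_def transpose_def)
    then show ?thesis using assms(2)[of i] by (metis abs_of_pos abs_mult_self_eq mult_cancel_left2 power2_eq_1_iff power2_eq_square abs_1 abs_minus_cancel)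
  qed
  ultimately show ?thesis by (auto simp: vec_eq_iff mat_def)
qed

text \<open>The inverse of \<open>M\<close> times \<open>L\<close> is lower triangular with positive
  diagonal, and it is orthogonal because the two Gram matrices agree.\<close>

lemma Cholesky_unique:
  fixes L M :: "'n::{finite,wellorder} sqmat"
  assumes L: "L \<in> LTs 0" "\<And>i. L $ i $ i > 0" and M: "M \<in> LTs 0" "\<And>i. M $ i $ i > 0"
    and eq: "L ** transpose L = M ** transpose M"
  shows "L = M"
proof -
  have "M $ i $ i \<noteq> 0" for i using M(2)[of i] by simp
  then obtain K where K: "K \<in> LTs 0" "M ** K = mat 1" "K ** M = mat 1"
    using LTs0_inverse[OF M(1)] by blast
  have A: "K ** L \<in> LTs 0" using LTs_mult[OF K(1) L(1)] by simp
  have "(K ** L) $ i $ i > 0" for i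
  proof -
    have "K $ i $ i * M $ i $ i = 1"
      using mult_diag_LTs0[OF K(1) M(1), of i] by (simp add: K(3) mat_def)
    then have "K $ i $ i > 0" using M(2)[of i] by (metis zero_less_mult_pos2 zero_less_one)
    then show ?thesis using mult_diag_LTs0[OF K(1) L(1), of i] L(2)[of i] by simp
  qed
  moreover have "(K ** L) ** transpose (K ** L) = mat 1"
  proof -
    have "(K ** L) ** transpose (K ** L) = K ** (L ** transpose L) ** transpose K"
      by (simp add: matrix_transpose_mul matrix_mul_assoc)
    also have "\<dots> = (K ** M) ** transpose (K ** M)"
      by (simp add: eq matrix_transpose_mul matrix_mul_assoc)
    finally show ?thesis by (simp add: K(3))
  qed
  ultimately have "K ** L = mat 1" by (rule lower_orthogonal_eq_mat1[OF A])
  then show ?thesis using K(2) by (metis matrix_mul_assoc matrix_mul_lid matrix_mul_rid)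
qed

text \<open>A Gram-Schmidt step for the form defined by \<open>C\<close>: the \<open>i\<close>-th
  basis vector is corrected by the earlier ones so as to be orthogonal to all of them.\<close>

lemma ex_orthogonal_combination:
  fixes C :: "'n::{finite,wellorder} sqmat"
  assumes pos: "\<And>x. x \<noteq> 0 \<Longrightarrow> x \<bullet> (C *v x) > 0"
  shows "\<exists>w. w $ i = 1 \<and> (\<forall>j. i < j \<longrightarrow> w $ j = 0) \<and> (\<forall>j<i. (C *v w) $ j = 0)"
proof -
  define restr :: "(real, 'n) vec \<Rightarrow> (real, 'n) vec" where "restr x = (\<chi> j. if j < i then x $ j else 0)" for x
  \<comment> \<open>\<open>T\<close> acts by the leading principal block of \<open>C\<close> on the
    coordinates before \<open>i\<close> and as the identity elsewhere. Solvability of the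
    orthogonality equations thus becomes surjectivity of an endomorphism of the whole space.\<close>
  define T :: "(real, 'n) vec \<Rightarrow> (real, 'n) vec" where
    "T x = (\<chi> j. if j < i then (C *v restr x) $ j else x $ j)" for x
  have lin: "linear restr" by (rule linearI) (auto simp: restr_def vec_eq_iff)
  then have linT: "linear T"
    by (intro linearI) (auto simp: T_def vec_eq_iff linear_add linear_scale matrix_vector_right_distrib
        matrix_vector_mult_scaleR)
  have "x = 0" if "T x = 0" for x
  proof -
    have Tx: "(C *v restr x) $ j = 0" if "j < i" for j
      using \<open>T x = 0\<close> that by (auto simp: T_def vec_eq_iff split: if_splits)
    have Tx': "x $ j = 0" if "\<not> j < i" for j
      using \<open>T x = 0\<close> that by (auto simp: T_def vec_eq_iff split: if_splits)
    have "restr x \<bullet> (C *v restr x) = (\<Sum>j\<in>UNIV. restr x $ j * (C *v restr x) $ j)"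
      by (simp add: inner_vec_def)
    also have "\<dots> = 0" proof (rule sum.neutral, safe)
      fix j
      show "restr x $ j * (C *v restr x) $ j = 0"
        by (cases "j < i") (simp add: Tx, simp add: restr_def)
    qed
    finally have "restr x = 0" using pos[of "restr x"] by force
    moreover have "restr x $ j = (if j < i then x $ j else 0)" for j by (simp add: restr_def)
    ultimately have "x $ j = 0" for j using Tx'[of j] by (metis zero_index)
    then show ?thesis by (simp add: vec_eq_iff)
  qed
  then have "inj T" using linT linear_injective_0 by blast
  then have "surj T" using linT linear_injective_imp_surjective by blast
  \<comment> \<open>The right-hand side offsets the contribution of \<open>axis i 1\<close> to the
    coordinates before \<open>i\<close>.\<close>
  then obtain x where x: "T x = (\<chi> j. if j < i then - C $ j $ i else 0)"
    unfolding surj_def by (blast dest: sym)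
  have x0: "x $ j = 0" if "\<not> j < i" for j
    using x that by (auto simp: T_def vec_eq_iff split: if_splits)
  then have rx: "restr x = x" by (auto simp: restr_def vec_eq_iff)
  have xi: "(C *v x) $ j = - C $ j $ i" if "j < i" for j
    using x that by (auto simp: T_def rx vec_eq_iff split: if_splits)
  show ?thesis
  proof (intro exI[of _ "axis i 1 + x"] conjI allI impI)
    show "(axis i 1 + x) $ i = 1" using x0[of i] by (simp add: axis_def)
    show "(axis i 1 + x) $ j = 0" if "i < j" for j using x0[of j] that by (simp add: axis_def)
    show "(C *v (axis i 1 + x)) $ j = 0" if "j < i" for j
      using xi[OF that] by (simp add: matrix_vector_right_distrib matrix_vector_mul_component inner_axis)
  qed
qed

text \<open>In the orthogonal basis formed by the rows of \<open>W\<close> the form is diagonal with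
  positive entries. Undoing the unitriangular change of basis and splitting the diagonal into square
  roots gives the factor.\<close>

lemma Cholesky_exists:
  fixes C :: "'n::{finite,wellorder} sqmat"
  assumes sym: "transpose C = C" and pos: "\<And>x. x \<noteq> 0 \<Longrightarrow> x \<bullet> (C *v x) > 0"
  shows "\<exists>L\<in>LTs 0. (\<forall>i. L $ i $ i > 0) \<and> C = L ** transpose L"
proof -
  have "\<exists>w. \<forall>i. w i $ i = 1 \<and> (\<forall>j. i < j \<longrightarrow> w i $ j = 0) \<and> (\<forall>j<i. (C *v w i) $ j = 0)"
    by (intro choice allI ex_orthogonal_combination[OF pos])
  then obtain w :: "'n \<Rightarrow> (real, 'n) vec" where w: "\<And>i. w i $ i = 1" "\<And>i j. i < j \<Longrightarrow> w i $ j = 0"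
      "\<And>i j. j < i \<Longrightarrow> (C *v w i) $ j = 0" by blast
  define W :: "'n sqmat" where "W = (\<chi> i. w i)"
  have W: "W \<in> LT1"
    using w(1,2) by (auto simp: LT1_iff LT0_def lower_triangular_def W_def mat_def)
  define e where "e i = w i \<bullet> (C *v w i)" for i
  have e: "e i > 0" for i unfolding e_def by (rule pos) (metis w(1) zero_index zero_neq_one)
  have "w i \<bullet> (C *v w j) = 0" if "i \<noteq> j" for i j
  proof -
    have *: "w i \<bullet> (C *v w j) = 0" if "i < j" for i j
      unfolding inner_vec_def
    proof (rule sum.neutral, safe)
      fix l
      show "w i $ l \<bullet> (C *v w j) $ l = 0"
        using that w(2)[of i l] w(3)[of l j] by (cases "i < l") auto
    qed
    have "w i \<bullet> (C *v w j) = w j \<bullet> (C *v w i)"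
      by (metis sym dot_lmul_matrix inner_commute transpose_matrix_vector)
    then show ?thesis using *[of i j] *[of j i] that by (cases "i < j") auto
  qed
  moreover have WCW: "(W ** C ** transpose W) $ i $ j = w i \<bullet> (C *v w j)" for i j
    by (simp add: W_def matrix_matrix_mult_def transpose_def inner_vec_def matrix_vector_mult_def
        sum_distrib_left sum_distrib_right mult.assoc) (rule sum.swap)
  ultimately have E: "W ** C ** transpose W = diagm e"
    by (auto simp: vec_eq_iff diagm_def e_def)
  let ?Z = "matrix_inv W"
  have ZW: "?Z ** W = mat 1" and ZL: "?Z \<in> LT1" using LT1_inverse[OF W] by auto
  let ?s = "\<lambda>i. sqrt (e i)"
  let ?L = "?Z ** diagm ?s"
  have ss: "diagm ?s ** diagm ?s = diagm e" using e by (simp add: diagm_mult less_imp_le)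
  have "C = (?Z ** W) ** C ** transpose (?Z ** W)" by (simp add: ZW)
  also have "\<dots> = ?Z ** diagm e ** transpose ?Z"
    by (simp add: E[symmetric] matrix_transpose_mul matrix_mul_assoc)
  also have "\<dots> = ?L ** transpose ?L"
    by (simp add: ss[symmetric] matrix_transpose_mul matrix_mul_assoc transpose_diagm)
  finally have "C = ?L ** transpose ?L" .
  moreover have "?L \<in> LTs 0" using LTs_mult[OF LT1_LTs[OF ZL] diagm_LTs0] by simp
  moreover have "?L $ i $ i > 0" for i using e by (simp add: diagm_mult_right LT1_diag[OF ZL])
  ultimately show ?thesis by blast
qed

lemma Chol_eqI:
  fixes L :: "'n::{finite,wellorder} sqmat"
  assumes "L \<in> LTs 0" "\<And>i. L $ i $ i > 0" "C = L ** transpose L"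
  shows "Chol C = L"
  unfolding Chol_def lower_triangular_iff_LTs
proof (rule the_equality)
  fix M assume M: "M \<in> LTs 0 \<and> (\<forall>i. M $ i $ i > 0) \<and> C = M ** transpose M"
  then have "M ** transpose M = L ** transpose L" using assms(3) by metis
  with M assms(1,2) show "M = L" using Cholesky_unique by blast
qed (use assms in blast)

section \<open>The inverse of \<open>\<Theta>\<close> as a global chart\<close>

definition low :: "'n::{finite,wellorder} sqmat \<Rightarrow> 'n sqmat" where
  "low M = (\<chi> i j. if j < i then M $ i $ j else 0)"

text \<open>A retraction onto \<open>LT1\<close>, which lets the maps below be defined on all
  matrices.\<close>

definition unitlow :: "'n::{finite,wellorder} sqmat \<Rightarrow> 'n sqmat" where
  "unitlow M = mat 1 + low M"

text \<open>The squared norm of a row, written as an entry of the Gram matrix so that smoothness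
  follows from bilinearity of the product.\<close>

definition sqrow :: "'n::{finite,wellorder} sqmat \<Rightarrow> 'n \<Rightarrow> real" where
  "sqrow M i = (unitlow M ** transpose (unitlow M)) $ i $ i"

definition rowscale :: "'n::{finite,wellorder} sqmat \<Rightarrow> 'n sqmat" where
  "rowscale M = diagm (\<lambda>i. sqrow M i powr (- 1 / 2))"

text \<open>A Gram matrix has unit diagonal exactly when the rows have length 1; the normalised rows
  form the Cholesky factor of \<open>Phi M\<close>.\<close>

definition unitrows :: "'n::{finite,wellorder} sqmat \<Rightarrow> 'n sqmat" where
  "unitrows M = rowscale M ** unitlow M"

definition Phi :: "'n::{finite,wellorder} sqmat \<Rightarrow> 'n sqmat" where
  "Phi M = unitrows M ** transpose (unitrows M)"

text \<open>Invariance of domain needs maps between spaces of equal dimension; \<open>chart\<close> extends \<open>Phi\<close>,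
  the inverse of \<open>\<Theta>\<close>, from the unitriangular matrices to an injective map on all matrices.\<close>

definition chart :: "'n::{finite,wellorder} sqmat \<Rightarrow> 'n sqmat" where
  "chart M = Phi M + (M - unitlow M)"

lemma low_LT0: "low M \<in> LT0"
  by (auto simp: low_def LT0_def lower_triangular_def)

lemma low_id: "A \<in> LT0 \<Longrightarrow> low A = A"
  by (auto simp: low_def LT0_def lower_triangular_def vec_eq_iff) (metis linorder_neqE)

lemma linear_low: "linear low"
  by (rule linearI) (auto simp: low_def vec_eq_iff)

lemma unitlow_LT1: "unitlow M \<in> LT1"
  by (simp add: LT1_iff unitlow_def low_LT0)

lemma unitlow_id: "Z \<in> LT1 \<Longrightarrow> unitlow Z = Z"
proof -
  assume Z: "Z \<in> LT1"
  have "low Z = low (Z - mat 1)" by (auto simp: low_def vec_eq_iff mat_def)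
  then show ?thesis using Z low_id[of "Z - mat 1"] by (simp add: unitlow_def LT1_iff)
qed

lemma sqrow_pos: "sqrow M i > 0"
proof -
  have "sqrow M i = (\<Sum>j\<in>UNIV. (unitlow M $ i $ j)\<^sup>2)"
    by (simp add: sqrow_def matrix_matrix_mult_def transpose_def power2_eq_square)
  also have "\<dots> \<ge> (unitlow M $ i $ i)\<^sup>2" by (rule member_le_sum) auto
  finally show ?thesis using LT1_diag[OF unitlow_LT1, of M i] by simp
qed

lemma unitrows_LTs0: "unitrows M \<in> LTs 0"
  using LTs_mult[OF diagm_LTs0 LT1_LTs[OF unitlow_LT1]] by (simp add: unitrows_def rowscale_def)

lemma unitrows_diag: "unitrows M $ i $ i = rowscale M $ i $ i"
  by (simp add: unitrows_def rowscale_def diagm_mult_left LT1_diag[OF unitlow_LT1])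
     (simp add: diagm_def)

lemma unitrows_diag_pos: "unitrows M $ i $ i > 0"
  unfolding unitrows_diag using sqrow_pos[of M i] by (simp add: rowscale_def diagm_def)

lemma Phi_diag: "Phi M $ i $ i = 1"
proof -
  let ?r = "sqrow M i powr (- 1 / 2)"
  have "Phi M = rowscale M ** (unitlow M ** transpose (unitlow M)) ** rowscale M"
    by (simp add: Phi_def unitrows_def matrix_transpose_mul matrix_mul_assoc rowscale_def transpose_diagm)
  then have "Phi M $ i $ i = ?r * sqrow M i * ?r"
    by (simp add: rowscale_def diagm_mult_left diagm_mult_right sqrow_def)
  also have "\<dots> = sqrow M i * (?r * ?r)" by simp
  also have "?r * ?r = inverse (sqrow M i)"
    using sqrow_pos[of M i] powr_add[of "sqrow M i" "- 1 / 2" "- 1 / 2"] by (simp add: powr_minus)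
  finally show ?thesis using sqrow_pos[of M i] by simp
qed

lemma Phi_sym: "transpose (Phi M) = Phi M"
  by (simp add: Phi_def matrix_transpose_mul)

lemma Phi_Cor_plus: "Phi M \<in> Cor_plus"
  unfolding Cor_plus_def
proof (intro CollectI conjI allI impI Phi_sym Phi_diag)
  fix x :: "(real, 'a) vec" assume "x \<noteq> 0"
  let ?L = "unitrows M"
  have "?L $ i $ i \<noteq> 0" for i using unitrows_diag_pos[of M i] by simp
  then obtain K where "?L ** K = mat 1" using LTs0_inverse[OF unitrows_LTs0] by blast
  then have "transpose K ** transpose ?L = mat 1" by (metis matrix_transpose_mul transpose_mat)
  then have "transpose ?L *v x \<noteq> 0"
    using \<open>x \<noteq> 0\<close> by (metis matrix_vector_mul_assoc matrix_vector_mul_lid matrix_vector_mult_0_right)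
  moreover have "x \<bullet> (Phi M *v x) = (transpose ?L *v x) \<bullet> (transpose ?L *v x)"
    unfolding Phi_def matrix_vector_mul_assoc[symmetric]
    by (metis dot_lmul_matrix transpose_matrix_vector)
  ultimately show "x \<bullet> (Phi M *v x) > 0" by simp
qed

lemma Chol_Phi: "Chol (Phi M) = unitrows M"
  by (rule Chol_eqI) (simp_all add: unitrows_LTs0 unitrows_diag_pos Phi_def)

lemma Diag_eq_diagm: "Diag M = diagm (\<lambda>i. M $ i $ i)"
  by (auto simp: Diag_def diagm_def vec_eq_iff)

lemma Theta_Phi: "Theta (Phi M) = unitlow M"
proof -
  have D: "Diag (unitrows M) = rowscale M"
    by (simp add: Diag_eq_diagm unitrows_diag) (simp add: rowscale_def diagm_def)
  have "sqrow M i powr (- 1 / 2) \<noteq> 0" for i using sqrow_pos[of M i] by simp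
  then have "rowscale M ** diagm (\<lambda>i. inverse (sqrow M i powr (- 1 / 2))) = mat 1"
    unfolding rowscale_def by (rule diagm_inverse)
  then have "matrix_inv (rowscale M) ** rowscale M = mat 1"
    using matrix_inv_unique_left matrix_left_right_inverse by metis
  then show ?thesis
    by (simp add: Theta_def Chol_Phi D) (simp add: unitrows_def matrix_mul_assoc)
qed

text \<open>The unit diagonal forces the scaling of the Cholesky factor:
  \<open>C $ i $ i = 1\<close> reads \<open>(L $ i $ i)\<^sup>2 * sqrow Z i = 1\<close>.\<close>

lemma Cor_plus_eq_Phi:
  assumes "C \<in> Cor_plus"
  obtains Z where "Z \<in> LT1" "C = Phi Z"
proof -
  obtain L where L: "L \<in> LTs 0" "\<And>i. L $ i $ i > 0" "C = L ** transpose L"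
    using Cholesky_exists[of C] assms unfolding Cor_plus_def by blast
  let ?D = "diagm (\<lambda>i. L $ i $ i)"
  have "L $ i $ i \<noteq> 0" for i using L(2)[of i] by simp
  then obtain Z where Z: "Z \<in> LT1" "L = ?D ** Z"
    using lower_triangular_factor[OF L(1)] by blast
  have uZ: "unitlow Z = Z" using unitlow_id Z by blast
  have "L $ i $ i = sqrow Z i powr (- 1 / 2)" for i
  proof -
    have "C = ?D ** (Z ** transpose Z) ** ?D"
      unfolding L(3) by (subst (1 2) Z(2)) (simp add: matrix_transpose_mul matrix_mul_assoc transpose_diagm)
    then have "C $ i $ i = (L $ i $ i)\<^sup>2 * sqrow Z i"
      by (simp add: diagm_mult_left diagm_mult_right sqrow_def uZ power2_eq_square)
    then have *: "(L $ i $ i)\<^sup>2 * sqrow Z i = 1" using assms by (simp add: Cor_plus_def)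
    then have "sqrow Z i = inverse ((L $ i $ i)\<^sup>2)"
      using inverse_unique[OF *] by simp
    also have "\<dots> = L $ i $ i powr (-2)"
      using L(2)[of i] by (simp add: powr_minus)
    finally show ?thesis using L(2)[of i] by (simp add: powr_powr)
  qed
  then have "L = unitrows Z"
    using Z(2) by (simp add: unitrows_def rowscale_def uZ)
  then show ?thesis using that Z(1) L(3) by (simp add: Phi_def)
qed

lemma Theta_LT1: "C \<in> Cor_plus \<Longrightarrow> Theta C \<in> LT1"
  by (metis Cor_plus_eq_Phi Theta_Phi unitlow_LT1)

lemma Phi_Theta: "C \<in> Cor_plus \<Longrightarrow> Phi (Theta C) = C"
  by (metis Cor_plus_eq_Phi Theta_Phi unitlow_id)

lemma chart_eq_Phi: "Z \<in> LT1 \<Longrightarrow> chart Z = Phi Z"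
  by (simp add: chart_def unitlow_id)

lemma chart_Theta: "C \<in> Cor_plus \<Longrightarrow> chart (Theta C) = C"
  by (simp add: chart_eq_Phi Theta_LT1 Phi_Theta)

lemma chart_Cor_plus: "Z \<in> LT1 \<Longrightarrow> chart Z \<in> Cor_plus"
  by (simp add: chart_eq_Phi Phi_Cor_plus)

lemma Theta_chart: "Z \<in> LT1 \<Longrightarrow> Theta (chart Z) = Z"
  by (simp add: chart_eq_Phi Theta_Phi unitlow_id)

lemma Theta_inv_eq_chart: "Z \<in> LT1 \<Longrightarrow> Theta_inv Z = chart Z"
  unfolding Theta_inv_def
  using inj_on_inverseI[of Cor_plus chart Theta, OF chart_Theta]
  by (intro the_inv_into_f_eq) (simp_all add: chart_Cor_plus Theta_chart)

lemma sym_eq_of_lower: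
  fixes A B :: "'n::{finite,wellorder} sqmat"
  assumes "transpose A = A" "transpose B = B" "\<And>i. A $ i $ i = B $ i $ i"
    and "\<And>i j. j < i \<Longrightarrow> A $ i $ j = B $ i $ j"
  shows "A = B"
proof -
  have "A $ i $ j = B $ i $ j" for i j
  proof (cases i j rule: linorder_cases)
    case less
    have "A $ j $ i = B $ j $ i" using assms(4) less .
    then show ?thesis using assms(1,2) by (metis (mono_tags, lifting) transpose_def vec_lambda_beta)
  qed (use assms in auto)
  then show ?thesis by (simp add: vec_eq_iff)
qed

text \<open>The added term \<open>M - unitlow M\<close> vanishes below the diagonal, so
  \<open>chart M\<close> reveals the strictly lower part of \<open>Phi M\<close>. By symmetry and
  the unit diagonal this determines \<open>Phi M\<close>, then \<open>unitlow M\<close> through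
  \<open>Theta\<close>, and finally the added term.\<close>

lemma inj_chart: "inj chart"
proof (rule injI)
  fix M N :: "'n::{finite,wellorder} sqmat"
  assume eq: "chart M = chart N"
  have low0: "(A - unitlow A) $ i $ j = 0" if "j < i" for A :: "'n sqmat" and i j
    using that by (simp add: unitlow_def low_def mat_def)
  have "Phi M = Phi N"
  proof (rule sym_eq_of_lower)
    show "Phi M $ i $ j = Phi N $ i $ j" if "j < i" for i j
      using arg_cong[OF eq, of "\<lambda>A. A $ i $ j"] low0[OF that, of M] low0[OF that, of N]
      by (simp add: chart_def)
  qed (simp_all add: Phi_sym Phi_diag)
  moreover from this have "unitlow M = unitlow N" by (metis Theta_Phi)
  ultimately show "M = N" using eq by (simp add: chart_def)
qed

section \<open>Smoothness of the chart\<close>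

lemma linear_entry: "linear (\<lambda>A::real^'n^'m. A $ i $ j)"
  by (rule linearI) auto

lemma bounded_linear_transpose: "bounded_linear (transpose :: real^'n^'m \<Rightarrow> real^'m^'n)"
  unfolding linear_conv_bounded_linear[symmetric]
  by (rule linearI) (auto simp: transpose_def vec_eq_iff)

lemma twice_diff_unitlow: "twice_diff unitlow"
  unfolding unitlow_def
  by (intro twice_diff_add twice_diff_const twice_diff_bounded_linear
      linear_conv_bounded_linear[THEN iffD1] linear_low)

lemma twice_diff_sqrow: "twice_diff (\<lambda>M. sqrow M i)"
  unfolding sqrow_def
  by (intro twice_diff_linear_compose[OF linear_conv_bounded_linear[THEN iffD1, OF linear_entry]]
      twice_diff_bilinear[OF bounded_bilinear_matrix_mult] twice_diff_unitlow
      twice_diff_linear_compose[OF bounded_linear_transpose])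

text \<open>Decomposed into scalar functions times fixed diagonal units, so only a power of
  \<open>sqrow\<close> must be differentiated, and positivity keeps it away from the singularity at
  0.\<close>

lemma twice_diff_rowscale: "twice_diff (rowscale :: 'n::{finite,wellorder} sqmat \<Rightarrow> _)"
proof -
  have rs: "rowscale M = (\<Sum>i\<in>UNIV. (sqrow M i powr (- 1 / 2)) *\<^sub>R diagm (\<lambda>k. if k = i then 1 else 0))"
    for M :: "'n sqmat"
    by (simp add: vec_eq_iff rowscale_def diagm_def if_distrib[of "\<lambda>x. _ * x"] cong: if_cong)
  have "twice_diff (\<lambda>M :: 'n sqmat. sqrow M i powr (- 1 / 2))" for i
  proof (rule twice_diff_real_compose[OF twice_diff_sqrow])
    fix M :: "'n sqmat"
    show "((\<lambda>x. x powr (- 1 / 2)) has_real_derivative (- 1 / 2) * sqrow M i powr (- 1 / 2 - 1)) (at (sqrow M i))"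
      by (rule has_real_derivative_powr[OF sqrow_pos])
    show "((\<lambda>x. (- 1 / 2) * x powr (- 1 / 2 - 1)) has_real_derivative
        (- 1 / 2) * ((- 1 / 2 - 1) * sqrow M i powr (- 1 / 2 - 1 - 1))) (at (sqrow M i))"
      by (rule DERIV_cmult[OF has_real_derivative_powr[OF sqrow_pos]])
  qed
  then show ?thesis
    unfolding rs[abs_def] 
    by (intro twice_diff_sum twice_diff_linear_compose[OF bounded_linear_scaleR_left])
qed

lemma twice_diff_unitrows: "twice_diff unitrows"
  unfolding unitrows_def[abs_def]
  by (intro twice_diff_bilinear[OF bounded_bilinear_matrix_mult] twice_diff_rowscale twice_diff_unitlow)

lemma twice_diff_Phi: "twice_diff Phi"
  unfolding Phi_def[abs_def]
  by (intro twice_diff_bilinear[OF bounded_bilinear_matrix_mult] twice_diff_unitrows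
      twice_diff_linear_compose[OF bounded_linear_transpose])

lemma chart_eq: "chart M = (Phi M + - mat 1) + (M - low M)"
  by (simp add: chart_def unitlow_def)

lemma linear_upper: "bounded_linear (\<lambda>M. M - low M)"
  by (intro bounded_linear_sub bounded_linear_ident linear_conv_bounded_linear[THEN iffD1] linear_low)

lemma twice_diff_chart: "twice_diff chart"
  unfolding chart_eq[abs_def]
  by (intro twice_diff_add twice_diff_Phi twice_diff_const twice_diff_bounded_linear linear_upper)

section \<open>The chart is an immersion and identifies \<open>LT0\<close> with
  \<open>Hol\<close>\<close>

lemma D1_eqI: "(f has_derivative f') (at x) \<Longrightarrow> D1 f x = f'"
  using frechet_derivative_at by metis

lemma D1_chart: "D1 chart M H = D1 Phi M H + (H - low H)"
proof -
  have "(chart has_derivative (\<lambda>H. (D1 Phi M H + 0) + (H - low H))) (at M)"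
    unfolding chart_eq[abs_def]
    by (intro has_derivative_add twice_diff_D1[OF twice_diff_Phi] has_derivative_const
        bounded_linear_imp_has_derivative[OF linear_upper])
  from D1_eqI[OF this] show ?thesis by simp
qed

text \<open>Carries linear constraints on the values of a map, such as symmetry, a fixed diagonal or
  vanishing entries, over to its derivative.\<close>

lemma D1_linear_constant:
  fixes f :: "'a::real_normed_vector \<Rightarrow> 'b::euclidean_space" and L :: "'b \<Rightarrow> real"
  assumes "twice_diff f" "linear L" "\<And>x. L (f x) = c"
  shows "L (D1 f x h) = 0"
proof -
  have 1: "((\<lambda>x. L (f x)) has_derivative (\<lambda>h. L (D1 f x h))) (at x)"
    using bounded_linear.has_derivative[OF _ twice_diff_D1[OF assms(1)]] assms(2)
    unfolding linear_conv_bounded_linear by blast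
  have "((\<lambda>x. L (f x)) has_derivative (\<lambda>h. 0)) (at x)" by (simp add: assms(3))
  from fun_cong[OF has_derivative_unique[OF 1 this]] show ?thesis .
qed

lemma D1_Phi_Hol: "D1 Phi M H \<in> Hol"
proof -
  have "linear (\<lambda>A::'a sqmat. A $ i $ j - A $ j $ i)" for i j
    by (rule linearI) (auto simp: algebra_simps)
  moreover have "Phi M $ i $ j - Phi M $ j $ i = 0" for M :: "'a sqmat" and i j
    using Phi_sym[of M] by (metis (mono_tags, lifting) diff_self transpose_def vec_lambda_beta)
  ultimately have "D1 Phi M H $ i $ j - D1 Phi M H $ j $ i = 0" for i j
    by (rule D1_linear_constant[OF twice_diff_Phi])
  moreover have "D1 Phi M H $ i $ i = 0" for i
    by (rule D1_linear_constant[OF twice_diff_Phi linear_entry Phi_diag])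
  ultimately show ?thesis by (simp add: Hol_def transpose_def vec_eq_iff)
qed

lemma Hol_eq_0I:
  assumes "A \<in> Hol" "\<And>i j. j < i \<Longrightarrow> A $ i $ j = 0"
  shows "A = 0"
proof (rule sym_eq_of_lower)
  show "A $ i $ j = 0 $ i $ j" if "j < i" for i j using assms(2)[OF that] by simp
qed (use assms(1) in \<open>simp_all add: Hol_def\<close>, simp add: transpose_def vec_eq_iff)

text \<open>Infinitesimal uniqueness of the Cholesky factor: after multiplication by the inverse of
  \<open>?L\<close> and its transpose, the differentiated Gram matrix says that \<open>?B\<close> is
  skew-symmetric, and a lower triangular skew-symmetric matrix is zero.\<close>

lemma unitrows_derivative_eq_0:
  assumes "D1 Phi M H = 0"
  shows "D1 unitrows M H = 0"
proof -
  let ?L = "unitrows M" and ?L' = "D1 unitrows M H"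
  have "((\<lambda>M. unitrows M ** transpose (unitrows M)) has_derivative
      (\<lambda>h. ?L ** transpose (D1 unitrows M h) + D1 unitrows M h ** transpose ?L)) (at M)"
    by (intro bounded_bilinear.FDERIV[OF bounded_bilinear_matrix_mult]
        bounded_linear.has_derivative[OF bounded_linear_transpose] twice_diff_D1 twice_diff_unitrows)
  from fun_cong[OF D1_eqI[OF this[folded Phi_def]], of H]
  have "D1 Phi M H = ?L ** transpose ?L' + ?L' ** transpose ?L" by simp
  then have sum0: "?L ** transpose ?L' + ?L' ** transpose ?L = 0" using assms by simp
  have L': "?L' \<in> LTs 0"
    unfolding LTs_def
  proof (intro CollectI allI impI)
    fix i j :: 'a assume "idx i < idx j + 0"
    then show "?L' $ i $ j = 0"
      using unitrows_LTs0 by (intro D1_linear_constant[OF twice_diff_unitrows linear_entry, of i j 0])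
        (auto simp: LTs_def)
  qed
  have "?L $ i $ i \<noteq> 0" for i using unitrows_diag_pos[of M i] by simp
  then obtain K where K: "K \<in> LTs 0" "?L ** K = mat 1" "K ** ?L = mat 1"
    using LTs0_inverse[OF unitrows_LTs0] by blast
  let ?B = "K ** ?L'"
  have B: "?B \<in> LTs 0" using LTs_mult[OF K(1) L'] by simp
  have "K ** (?L ** transpose ?L' + ?L' ** transpose ?L) ** transpose K
      = (K ** ?L) ** (transpose ?L' ** transpose K) + (K ** ?L') ** (transpose ?L ** transpose K)"
    by (simp add: mm.add_left mm.add_right matrix_mul_assoc)
  also have "\<dots> = transpose ?B + ?B"
    by (simp add: K(3) flip: matrix_transpose_mul)
  finally have "(transpose ?B + ?B) $ i $ j = 0" for i j by (simp add: sum0)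
  then have skew: "?B $ j $ i + ?B $ i $ j = 0" for i j by (simp add: transpose_def)
  have "?B $ i $ j = 0" for i j
  proof (cases i j rule: linorder_cases)
    case less then show ?thesis using B by (simp add: LTs_def idx_less_iff)
  next
    case equal then show ?thesis using skew[of i i] by simp
  next
    case greater
    then have "?B $ j $ i = 0" using B by (simp add: LTs_def idx_less_iff)
    then show ?thesis using skew[of i j] by simp
  qed
  then have "?B = 0" by (simp add: vec_eq_iff)
  then have "?L ** ?B = 0" by simp
  then show ?thesis using K(2) by (simp add: matrix_mul_assoc)
qed

text \<open>In the product rule for \<open>rowscale M ** unitlow M\<close> the term with
  \<open>low H\<close> has zero diagonal. The diagonal entries therefore annihilate the derivative
  of the scaling, and only \<open>rowscale M ** low H\<close> remains, with an invertible
  factor.\<close>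

lemma low_eq_0_of_D1_Phi:
  assumes "D1 Phi M H = 0"
  shows "low H = 0"
proof -
  let ?S = "rowscale M" and ?S' = "D1 rowscale M H"
  have "(unitlow has_derivative (\<lambda>h. 0 + low h)) (at M)"
    unfolding unitlow_def[abs_def]
    by (intro has_derivative_add has_derivative_const bounded_linear_imp_has_derivative
        linear_conv_bounded_linear[THEN iffD1] linear_low)
  then have "((\<lambda>M. rowscale M ** unitlow M) has_derivative
      (\<lambda>h. ?S ** (0 + low h) + D1 rowscale M h ** unitlow M)) (at M)"
    by (intro bounded_bilinear.FDERIV[OF bounded_bilinear_matrix_mult] twice_diff_D1 twice_diff_rowscale)
  from fun_cong[OF D1_eqI[OF this[folded unitrows_def]], of H]
  have "D1 unitrows M H = ?S ** low H + ?S' ** unitlow M" by simp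
  then have eq0: "?S ** low H + ?S' ** unitlow M = 0"
    using unitrows_derivative_eq_0[OF assms] by simp
  have "?S' $ i $ j = 0" if "i \<noteq> j" for i j
    using that by (intro D1_linear_constant[OF twice_diff_rowscale linear_entry, of i j 0])
      (simp add: rowscale_def diagm_def)
  then have S': "?S' = diagm (\<lambda>i. ?S' $ i $ i)" by (simp add: diagm_def vec_eq_iff)
  have entry: "sqrow M i powr (- 1 / 2) * low H $ i $ j + ?S' $ i $ i * unitlow M $ i $ j = 0" for i j
  proof -
    have "(?S ** low H + ?S' ** unitlow M) $ i $ j = 0" using eq0 by simp
    then show ?thesis
      by (subst (asm) S') (simp add: rowscale_def diagm_mult_left)
  qed
  have "?S' $ i $ i = 0" for i
    using entry[of i i] LT1_diag[OF unitlow_LT1, of M i] by (simp add: low_def)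
  then have "sqrow M i powr (- 1 / 2) * low H $ i $ j = 0" for i j using entry[of i j] by simp
  moreover have "sqrow M i powr (- 1 / 2) \<noteq> 0" for i using sqrow_pos[of M i] by simp
  ultimately show ?thesis by (simp add: vec_eq_iff)
qed

text \<open>The linearised form of \<open>inj_chart\<close>: below the diagonal the derivative is
  that of \<open>Phi\<close>, and an element of \<open>Hol\<close> is determined by this
  part.\<close>

lemma inj_D1_chart: "inj (D1 chart M)"
proof -
  have "H = 0" if "D1 chart M H = 0" for H
  proof -
    have eq: "D1 Phi M H + (H - low H) = 0" using that by (simp add: D1_chart)
    have "D1 Phi M H = 0"
    proof (rule Hol_eq_0I[OF D1_Phi_Hol])
      show "D1 Phi M H $ i $ j = 0" if "j < i" for i j
        using arg_cong[OF eq, of "\<lambda>A. A $ i $ j"] that by (simp add: low_def)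
    qed
    then show "H = 0" using low_eq_0_of_D1_Phi eq by force
  qed
  then show ?thesis using linear_injective_0[OF linear_D1[OF twice_diff_chart]] by blast
qed

lemma D1_chart_Hol: "H \<in> LT0 \<Longrightarrow> D1 chart M H \<in> Hol"
  by (simp add: D1_chart low_id D1_Phi_Hol)

text \<open>Surjectivity on all matrices is a dimension count. The preimage of \<open>V\<close> has
  no part on or above the diagonal, because \<open>D1 Phi M H\<close> and \<open>V\<close> both lie
  in \<open>Hol\<close> and agree below it.\<close>

lemma D1_chart_surj:
  assumes "V \<in> Hol"
  obtains H where "H \<in> LT0" "D1 chart M H = V"
proof -
  have "surj (D1 chart M)"
    using linear_injective_imp_surjective[OF linear_D1[OF twice_diff_chart] inj_D1_chart] by simp
  then obtain H where H: "D1 chart M H = V" by (metis surjD)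
  have "D1 Phi M H = V"
  proof (rule sym_eq_of_lower)
    show "D1 Phi M H $ i $ j = V $ i $ j" if "j < i" for i j
      using arg_cong[OF H, of "\<lambda>A. A $ i $ j"] that by (simp add: D1_chart low_def)
  qed (use assms D1_Phi_Hol[of M H] in \<open>simp_all add: Hol_def\<close>)
  then have "H = low H" using H by (simp add: D1_chart)
  then show ?thesis using that H low_LT0 by metis
qed

section \<open>Differentials of maps on \<open>Cor_plus\<close>\<close>

lemma diff_at_works:
  "(f has_derivative f') (at C within Cor_plus) \<Longrightarrow> (f has_derivative diff_at f C) (at C within Cor_plus)"
  unfolding diff_at_def using frechet_derivative_works differentiableI by blast

text \<open>Each \<open>V\<close> in \<open>Hol\<close> is the velocity of a curve inside
  \<open>Cor_plus\<close>, the image of a line in \<open>LT1\<close> under the chart, and the chain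
  rule along it reads off any derivative within \<open>Cor_plus\<close>.\<close>

lemma diff_at_eqI:
  assumes C: "C \<in> Cor_plus" and V: "V \<in> Hol" and f: "(f has_derivative f') (at C within Cor_plus)"
  shows "diff_at f C V = f' V"
proof -
  obtain H where H: "H \<in> LT0" "D1 chart (Theta C) H = V" using D1_chart_surj[OF V] .
  define p where "p t = chart (Theta C + t *\<^sub>R H)" for t :: real
  have p0: "p 0 = C" by (simp add: p_def chart_Theta[OF C])
  have "Theta C + t *\<^sub>R H \<in> LT1" for t
    using LT1_add[OF Theta_LT1[OF C], of "t *\<^sub>R H" 1] subspace_scale[OF subspace_LT0 H(1)]
    by (simp add: LT0_eq_LTs)
  then have pC: "range p \<subseteq> Cor_plus" by (auto simp: p_def chart_Cor_plus)
  have "((\<lambda>t. Theta C + t *\<^sub>R H) has_vector_derivative H) (at 0)"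
    by (auto intro!: derivative_eq_intros)
  from twice_diff_has_vector_derivative[OF twice_diff_chart this]
  have p: "(p has_vector_derivative V) (at 0)" unfolding p_def by (simp add: H(2))
  have *: "(f \<circ> p has_vector_derivative g V) (at 0)" if "(f has_derivative g) (at C within Cor_plus)" for g
    using that p pC p0 by (intro vector_derivative_diff_chain_within) (auto intro: has_derivative_subset)
  show ?thesis
    using vector_derivative_unique_at[OF *[OF diff_at_works[OF f]] *[OF f]] .
qed

text \<open>On \<open>Cor_plus\<close> the map \<open>Theta\<close> coincides with the inverse of
  the chart, which is differentiable as a map on all matrices at the points of its open
  domain.\<close>

lemma Theta_has_derivative:
  assumes "C \<in> Cor_plus"
  shows "(Theta has_derivative inv (D1 chart (Theta C))) (at C within Cor_plus)"
proof -
  have "(inv chart has_derivative inv (D1 chart (Theta C))) (at (chart (Theta C)))"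
    by (rule inv_has_derivative[OF inj_chart twice_diff_D1[OF twice_diff_chart] inj_D1_chart])
  then have "(inv chart has_derivative inv (D1 chart (Theta C))) (at C within Cor_plus)"
    by (simp add: chart_Theta[OF assms] has_derivative_at_withinI)
  then show ?thesis
  proof (rule has_derivative_transform[OF assms, rotated])
    show "Theta x = inv chart x" if "x \<in> Cor_plus" for x
      using inv_f_f[OF inj_chart, of "Theta x"] by (simp add: chart_Theta[OF that])
  qed
qed

lemma
  assumes C: "C \<in> Cor_plus"
  shows diff_at_Theta_D1: "H \<in> LT0 \<Longrightarrow> diff_at Theta C (D1 chart (Theta C) H) = H"
    and D1_diff_at_Theta: "V \<in> Hol \<Longrightarrow> D1 chart (Theta C) (diff_at Theta C V) = V"
    and diff_at_Theta_LT0: "V \<in> Hol \<Longrightarrow> diff_at Theta C V \<in> LT0"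
proof -
  show *: "diff_at Theta C (D1 chart (Theta C) H) = H" if "H \<in> LT0" for H
    using diff_at_eqI[OF C D1_chart_Hol[OF that] Theta_has_derivative[OF C]]
    by (simp add: inv_f_f[OF inj_D1_chart])
  assume "V \<in> Hol"
  then obtain H where "H \<in> LT0" "D1 chart (Theta C) H = V" using D1_chart_surj by blast
  then show "D1 chart (Theta C) (diff_at Theta C V) = V" "diff_at Theta C V \<in> LT0"
    using * by auto
qed

lemma linear_diff_at_Theta: "C \<in> Cor_plus \<Longrightarrow> linear (diff_at Theta C)"
  using has_derivative_linear[OF diff_at_works[OF Theta_has_derivative]] .

text \<open>The chain rule in the coordinates \<open>Theta\<close>. A formula for \<open>f\<close>
  on \<open>Cor_plus\<close> suffices, as the derivative is taken within that set.\<close>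

lemma diff_at_compose_Theta:
  assumes C: "C \<in> Cor_plus" and V: "V \<in> Hol" and F: "(F has_derivative F') (at (Theta C))"
    and f: "\<And>C'. C' \<in> Cor_plus \<Longrightarrow> f C' = F (Theta C')"
  shows "diff_at f C V = F' (diff_at Theta C V)"
proof -
  have "((\<lambda>C. F (Theta C)) has_derivative (\<lambda>V. F' (diff_at Theta C V))) (at C within Cor_plus)"
    by (rule has_derivative_compose[OF diff_at_works[OF Theta_has_derivative[OF C]] F])
  then have "(f has_derivative (\<lambda>V. F' (diff_at Theta C V))) (at C within Cor_plus)"
    by (rule has_derivative_transform[OF C f, rotated])
  then show ?thesis by (rule diff_at_eqI[OF C V])
qed

section \<open>Left-invariant fields and the Cartan-Schouten connection\<close>

lemma lc_mult_eq_chart: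
  "A \<in> Cor_plus \<Longrightarrow> C \<in> Cor_plus \<Longrightarrow> lc_mult A C = chart (Theta A ** Theta C)"
  by (simp add: lc_mult_def Theta_inv_eq_chart LT1_mult Theta_LT1)

lemma lc_mult_Cor_plus: "A \<in> Cor_plus \<Longrightarrow> C \<in> Cor_plus \<Longrightarrow> lc_mult A C \<in> Cor_plus"
  by (simp add: lc_mult_eq_chart chart_Cor_plus LT1_mult Theta_LT1)

lemma diff_at_lc_mult:
  assumes A: "A \<in> Cor_plus" and C: "C \<in> Cor_plus" and V: "V \<in> Hol"
  shows "diff_at (lc_mult A) C V = D1 chart (Theta A ** Theta C) (Theta A ** diff_at Theta C V)"
proof (rule diff_at_compose_Theta[OF C V])
  show "((\<lambda>Z. chart (Theta A ** Z)) has_derivative (\<lambda>H. D1 chart (Theta A ** Theta C) (Theta A ** H))) (at (Theta C))"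
    by (rule has_derivative_compose[OF bounded_linear_imp_has_derivative[OF mm.bounded_linear_right]
          twice_diff_D1[OF twice_diff_chart]])
qed (simp add: lc_mult_eq_chart A)

text \<open>The left-invariant field Z |-> Z A of the matrix group, pushed forward by the
  chart.\<close>

definition xfield :: "'n::{finite,wellorder} sqmat \<Rightarrow> 'n sqmat \<Rightarrow> 'n sqmat" where
  "xfield A C = D1 chart (Theta C) (Theta C ** A)"

lemma xfield_Hol: "C \<in> Cor_plus \<Longrightarrow> A \<in> LT0 \<Longrightarrow> xfield A C \<in> Hol"
  by (simp add: xfield_def D1_chart_Hol LT0_mult_left LT1_LTs Theta_LT1)

lemma diff_at_Theta_xfield:
  "C \<in> Cor_plus \<Longrightarrow> A \<in> LT0 \<Longrightarrow> diff_at Theta C (xfield A C) = Theta C ** A"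
  by (simp add: xfield_def diff_at_Theta_D1 LT0_mult_left LT1_LTs Theta_LT1)

text \<open>Left translation recovers the field from its value at the neutral element
  \<open>chart (mat 1)\<close>; \<open>A\<close> is this value in coordinates.\<close>

lemma left_invariant_field_iff:
  "left_invariant_field X \<longleftrightarrow> (\<exists>A\<in>LT0. \<forall>C\<in>Cor_plus. X C = xfield A C)"
proof
  assume X: "left_invariant_field X"
  let ?E = "chart (mat 1)"
  have E: "?E \<in> Cor_plus" "Theta ?E = mat 1" by (simp_all add: chart_Cor_plus Theta_chart mat1_LT1)
  have XE: "X ?E \<in> Hol" using X E unfolding left_invariant_field_def by blast
  have "X C = xfield (diff_at Theta ?E (X ?E)) C" if C: "C \<in> Cor_plus" for C
  proof -
    have "X C = X (lc_mult C ?E)" by (simp add: lc_mult_eq_chart C E chart_Theta)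
    also have "\<dots> = diff_at (lc_mult C) ?E (X ?E)"
      using X E(1) C unfolding left_invariant_field_def by metis
    also have "\<dots> = xfield (diff_at Theta ?E (X ?E)) C"
      by (simp add: diff_at_lc_mult[OF C E(1) XE] E(2) xfield_def)
    finally show ?thesis .
  qed
  then show "\<exists>A\<in>LT0. \<forall>C\<in>Cor_plus. X C = xfield A C"
    using diff_at_Theta_LT0[OF E(1) XE] by blast
next
  assume "\<exists>A\<in>LT0. \<forall>C\<in>Cor_plus. X C = xfield A C"
  then obtain A where A: "A \<in> LT0" and X: "\<And>C. C \<in> Cor_plus \<Longrightarrow> X C = xfield A C" by blast
  show "left_invariant_field X"
    unfolding left_invariant_field_def
  proof (intro conjI ballI)
    fix C :: "'a sqmat" assume C: "C \<in> Cor_plus"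
    then show "X C \<in> Hol" by (simp add: X xfield_Hol A)
    fix B :: "'a sqmat" assume B: "B \<in> Cor_plus"
    have "diff_at (lc_mult B) C (X C) = D1 chart (Theta B ** Theta C) (Theta B ** Theta C ** A)"
      by (simp add: diff_at_lc_mult B C X xfield_Hol A diff_at_Theta_xfield matrix_mul_assoc)
    also have "\<dots> = X (lc_mult B C)"
      by (simp add: X lc_mult_Cor_plus B C) (simp add: xfield_def lc_mult_eq_chart B C Theta_chart LT1_mult Theta_LT1)
    finally show "diff_at (lc_mult B) C (X C) = X (lc_mult B C)" .
  qed
qed

lemma diff_at_xfield:
  assumes C: "C \<in> Cor_plus" and V: "V \<in> Hol"
    and Y: "\<And>C. C \<in> Cor_plus \<Longrightarrow> Y C = xfield B C"
  shows "diff_at Y C V = D2 chart (Theta C) (diff_at Theta C V) (Theta C ** B)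
           + D1 chart (Theta C) (diff_at Theta C V ** B)"
proof (rule diff_at_compose_Theta[OF C V])
  let ?Z = "Theta C"
  have "((\<lambda>Z. (Z, Z ** B)) has_derivative (\<lambda>H. (H, H ** B))) (at ?Z)"
    by (intro has_derivative_Pair has_derivative_ident
        bounded_linear_imp_has_derivative[OF mm.bounded_linear_left])
  from has_derivative_compose[OF this D1_has_derivative_joint[OF twice_diff_chart]]
  show "((\<lambda>Z. D1 chart Z (Z ** B)) has_derivative
      (\<lambda>H. D2 chart ?Z H (?Z ** B) + D1 chart ?Z (H ** B))) (at ?Z)" by simp
qed (simp add: Y xfield_def)

text \<open>The second derivatives of the chart cancel by symmetry, which leaves the matrix
  commutator.\<close>

lemma lie_bracket_xfield:
  assumes C: "C \<in> Cor_plus" and AB: "A \<in> LT0" "B \<in> LT0"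
    and X: "\<And>C. C \<in> Cor_plus \<Longrightarrow> X C = xfield A C"
    and Y: "\<And>C. C \<in> Cor_plus \<Longrightarrow> Y C = xfield B C"
  shows "lie_bracket X Y C = xfield (A ** B - B ** A) C"
proof -
  let ?Z = "Theta C"
  have XY: "X C \<in> Hol" "Y C \<in> Hol" using C AB by (simp_all add: X Y xfield_Hol)
  have "lie_bracket X Y C = (D2 chart ?Z (?Z ** A) (?Z ** B) + D1 chart ?Z (?Z ** A ** B))
      - (D2 chart ?Z (?Z ** B) (?Z ** A) + D1 chart ?Z (?Z ** B ** A))"
    using diff_at_xfield[of C "X C" Y B] diff_at_xfield[of C "Y C" X A] C XY X Y
    by (simp add: lie_bracket_def AB diff_at_Theta_xfield)
  also have "\<dots> = D1 chart ?Z (?Z ** A ** B) - D1 chart ?Z (?Z ** B ** A)"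
    using D2_sym[OF twice_diff_chart, of ?Z "?Z ** A" "?Z ** B"] by simp
  also have "\<dots> = xfield (A ** B - B ** A) C"
    by (simp add: xfield_def mm.diff_right matrix_mul_assoc linear_diff[OF linear_D1[OF twice_diff_chart]])
  finally show ?thesis .
qed

lemma cov_deriv_xfield:
  assumes C: "C \<in> Cor_plus" and AB: "A \<in> LT0" "B \<in> LT0"
    and X: "\<And>C. C \<in> Cor_plus \<Longrightarrow> X C = xfield A C"
    and Y: "\<And>C. C \<in> Cor_plus \<Longrightarrow> Y C = xfield B C"
  shows "cov_deriv \<Gamma> X Y C = D2 chart (Theta C) (Theta C ** A) (Theta C ** B)
     + D1 chart (Theta C) (Theta C ** A ** B) + \<Gamma> C (xfield A C) (xfield B C)"
proof -
  have XC: "X C \<in> Hol" using C AB by (simp add: X xfield_Hol)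
  show ?thesis
    using diff_at_xfield[of C "X C" Y B] C XC X Y
    by (simp add: cov_deriv_def AB diff_at_Theta_xfield)
qed

text \<open>For \<open>w\<close> in \<open>LT0\<close> the map x |-> \<open>D1 chart x w\<close>
  stays in the subspace \<open>Hol\<close>, hence so does its derivative; this is tested on linear
  functionals vanishing on \<open>Hol\<close>.\<close>

lemma D2_chart_Hol:
  assumes "w \<in> LT0" shows "D2 chart M u w \<in> Hol"
proof -
  have D2: "L (D2 chart M u w) = 0"
    if L: "linear L" and 0: "\<And>V. V \<in> Hol \<Longrightarrow> L V = 0" for L :: "'a sqmat \<Rightarrow> real"
  proof -
    have 1: "((\<lambda>x. L (D1 chart x w)) has_derivative (\<lambda>h. L (D2 chart M h w))) (at M)"
      using bounded_linear.has_derivative[OF _ twice_diff_D2[OF twice_diff_chart]] L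
      unfolding linear_conv_bounded_linear by blast
    have "((\<lambda>x. L (D1 chart x w)) has_derivative (\<lambda>h. 0)) (at M)"
      by (simp add: 0 D1_chart_Hol assms)
    from fun_cong[OF has_derivative_unique[OF 1 this]] show ?thesis .
  qed
  show ?thesis
    unfolding Hol_def
  proof (intro CollectI conjI allI)
    show "D2 chart M u w $ i $ i = 0" for i
      by (rule D2[OF linear_entry]) (simp add: Hol_def)
    have "linear (\<lambda>A::'a sqmat. A $ j $ i - A $ i $ j)" for i j
      by (rule linearI) (auto simp: algebra_simps)
    then have "D2 chart M u w $ j $ i - D2 chart M u w $ i $ j = 0" for i j
      by (rule D2) (simp add: Hol_def transpose_def vec_eq_iff)
    then show "transpose (D2 chart M u w) = D2 chart M u w"
      by (simp add: transpose_def vec_eq_iff)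
  qed
qed

text \<open>Obtained by solving nabla_X Y = (1/2)[X, Y] for the Christoffel map: the ordinary
  derivative contributes \<open>D2 chart Z u w\<close> and the image of Z A B, and subtracting these
  from half the commutator leaves minus half the anticommutator. With u = Z A and w = Z B the
  product Z A B becomes \<open>u ** matrix_inv Z ** w\<close>.\<close>

definition cs_form :: "'n::{finite,wellorder} christoffel" where
  "cs_form C V W = (let Z = Theta C; u = diff_at Theta C V; w = diff_at Theta C W in
     - D2 chart Z u w - (1 / 2) *\<^sub>R D1 chart Z (u ** matrix_inv Z ** w + w ** matrix_inv Z ** u))"

lemma affine_connection_cs_form: "affine_connection cs_form"
  unfolding affine_connection_def
proof (intro ballI conjI)
  fix C :: "'a sqmat" assume C: "C \<in> Cor_plus"
  let ?Z = "Theta C" and ?d = "diff_at Theta C"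
  note d = linear_diff_at_Theta[OF C] and l = linear_D1[OF twice_diff_chart]
    and l2 = linear_D2[OF twice_diff_chart]
  have lin: "linear (\<lambda>V. cs_form C V W)" "linear (cs_form C V)" for V W
    unfolding cs_form_def Let_def
    by (rule linearI; simp add: linear_add[OF d] linear_scale[OF d] linear_add[OF l] linear_scale[OF l]
        linear_add[OF l2(1)] linear_scale[OF l2(1)] linear_add[OF l2(2)] linear_scale[OF l2(2)]
        mm.add_left mm.add_right mm.scaleR_left mm.scaleR_right algebra_simps)+
  then show "bilinear (cs_form C)" by (simp add: bilinear_def)
  fix V W :: "'a sqmat" assume VW: "V \<in> Hol" "W \<in> Hol"
  have sub: "subspace (Hol :: 'a sqmat set)"
    by (auto simp: subspace_def Hol_def transpose_def vec_eq_iff)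
  have Zi: "matrix_inv ?Z \<in> LTs 0" using LT1_LTs LT1_inverse(4) Theta_LT1[OF C] by blast
  have dV: "?d V \<in> LT0" "?d W \<in> LT0" using diff_at_Theta_LT0[OF C] VW by auto
  have LT0_LTs0: "A \<in> LT0 \<Longrightarrow> A \<in> LTs 0" for A :: "'a sqmat"
    using LTs_mono[of 0 1 A] by (simp add: LT0_eq_LTs)
  have "?d V ** matrix_inv ?Z ** ?d W \<in> LT0" "?d W ** matrix_inv ?Z ** ?d V \<in> LT0"
    using LT0_mult_right[OF LT0_mult_right[OF _ Zi] LT0_LTs0] dV by blast+
  then show "cs_form C V W \<in> Hol"
    unfolding cs_form_def Let_def
    by (intro subspace_diff[OF sub] subspace_neg[OF sub] subspace_scale[OF sub] D2_chart_Hol dV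
        D1_chart_Hol subspace_add[OF subspace_LT0])
qed

lemma cov_deriv_cs_form:
  assumes C: "C \<in> Cor_plus" and AB: "A \<in> LT0" "B \<in> LT0"
    and X: "\<And>C. C \<in> Cor_plus \<Longrightarrow> X C = xfield A C"
    and Y: "\<And>C. C \<in> Cor_plus \<Longrightarrow> Y C = xfield B C"
  shows "cov_deriv cs_form X Y C = xfield ((1 / 2) *\<^sub>R (A ** B - B ** A)) C"
proof -
  let ?Z = "Theta C"
  note l = linear_D1[OF twice_diff_chart, of ?Z]
  have Z: "?Z \<in> LT1" by (rule Theta_LT1[OF C])
  have ZA: "?Z ** A ** matrix_inv ?Z ** (?Z ** B) = ?Z ** A ** B" for A B
    using LT1_inverse(3)[OF Z] by (metis matrix_mul_assoc matrix_mul_rid)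
  have cs: "cs_form C (xfield A C) (xfield B C)
      = - D2 chart ?Z (?Z ** A) (?Z ** B) - (1 / 2) *\<^sub>R D1 chart ?Z (?Z ** A ** B + ?Z ** B ** A)"
    using C AB by (simp add: cs_form_def Let_def diff_at_Theta_xfield ZA)
  have "cov_deriv cs_form X Y C
      = D1 chart ?Z (?Z ** A ** B) - (1 / 2) *\<^sub>R D1 chart ?Z (?Z ** A ** B + ?Z ** B ** A)"
    by (simp add: cov_deriv_xfield[OF C AB X Y] cs)
  also have "\<dots> = D1 chart ?Z (?Z ** A ** B - (1 / 2) *\<^sub>R (?Z ** A ** B + ?Z ** B ** A))"
    by (simp only: linear_diff[OF l] linear_scale[OF l])
  also have "?Z ** A ** B - (1 / 2) *\<^sub>R (?Z ** A ** B + ?Z ** B ** A)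
      = (1 / 2) *\<^sub>R (?Z ** A ** B - ?Z ** B ** A)"
    by (simp add: vec_eq_iff field_simps)
  also have "\<dots> = ?Z ** ((1 / 2) *\<^sub>R (A ** B - B ** A))"
    by (simp add: mm.scaleR_right mm.diff_right matrix_mul_assoc)
  finally show ?thesis by (simp add: xfield_def)
qed

lemma commutator_LT0:
  assumes "A \<in> LT0" "B \<in> LT0" shows "A ** B - B ** A \<in> LT0"
proof -
  have "A \<in> LTs 0" "B \<in> LTs 0" using assms LTs_mono[of 0 1] by (auto simp: LT0_eq_LTs)
  then show ?thesis using assms by (intro subspace_diff[OF subspace_LT0] LT0_mult_left)
qed

lemma cartan_schouten_cs_form: "cartan_schouten cs_form"
  unfolding cartan_schouten_def left_invariant_connection_def
proof (intro conjI allI impI ballI affine_connection_cs_form)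
  fix X Y :: "'a sqmat \<Rightarrow> 'a sqmat"
  assume "left_invariant_field X" "left_invariant_field Y"
  then obtain A B where AB: "A \<in> LT0" "B \<in> LT0"
    and X: "\<And>C. C \<in> Cor_plus \<Longrightarrow> X C = xfield A C"
    and Y: "\<And>C. C \<in> Cor_plus \<Longrightarrow> Y C = xfield B C"
    unfolding left_invariant_field_iff by blast
  show "left_invariant_field (cov_deriv cs_form X Y)"
    unfolding left_invariant_field_iff
    using cov_deriv_cs_form[OF _ AB X Y] subspace_scale[OF subspace_LT0 commutator_LT0[OF AB]] by blast
  show "cov_deriv cs_form X Y C = (1 / 2) *\<^sub>R lie_bracket X Y C" if C: "C \<in> Cor_plus" for C
    using cov_deriv_cs_form[OF C AB X Y] lie_bracket_xfield[OF C AB X Y]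
    by (simp add: xfield_def mm.scaleR_right linear_scale[OF linear_D1[OF twice_diff_chart]])
qed

text \<open>\<open>cs_form\<close> guarantees that the chosen connection has the defining property.
  Extending \<open>V\<close> to a left-invariant field, whose bracket with itself is zero, then
  isolates the Christoffel term.\<close>

lemma lc_connection_diagonal:
  assumes C: "C \<in> Cor_plus" and u: "u \<in> LT0" and V: "D1 chart (Theta C) u = V"
  shows "lc_connection C V V
    = - (D2 chart (Theta C) u u + D1 chart (Theta C) (u ** matrix_inv (Theta C) ** u))"
proof -
  let ?Z = "Theta C"
  have cs: "cartan_schouten (lc_connection :: 'a christoffel)"
    unfolding lc_connection_def by (rule someI[of cartan_schouten, OF cartan_schouten_cs_form])
  have Z: "?Z \<in> LT1" by (rule Theta_LT1[OF C])
  define A where "A = matrix_inv ?Z ** u"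
  have A: "A \<in> LT0" unfolding A_def using LT0_mult_left u LT1_LTs LT1_inverse(4)[OF Z] by blast
  have ZA: "?Z ** A = u" by (simp add: A_def matrix_inv_cancel[OF Z])
  have ZAA: "?Z ** A ** A = u ** matrix_inv ?Z ** u" by (simp add: ZA) (simp add: A_def matrix_mul_assoc)
  have lif: "left_invariant_field (xfield A)" using A left_invariant_field_iff by blast
  have "cov_deriv lc_connection (xfield A) (xfield A) C = (1 / 2) *\<^sub>R lie_bracket (xfield A) (xfield A) C"
    using cs lif C unfolding cartan_schouten_def by blast
  also have "\<dots> = 0" by (simp add: lie_bracket_def)
  finally have "D2 chart ?Z u u + D1 chart ?Z (u ** matrix_inv ?Z ** u) + lc_connection C (xfield A C) (xfield A C) = 0"
    using cov_deriv_xfield[OF C A A, of "xfield A" "xfield A" lc_connection] ZA ZAA by simp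
  moreover have "xfield A C = V" by (simp add: xfield_def ZA V)
  ultimately show ?thesis by (simp only: add_eq_0_iff)
qed

section \<open>Geodesics, logarithms and group means\<close>

lemma has_vector_derivative_Hol:
  assumes "t \<in> J" "at t within J \<noteq> bot" and \<gamma>: "\<And>s. s \<in> J \<Longrightarrow> \<gamma> s \<in> Cor_plus"
    and v: "(\<gamma> has_vector_derivative v) (at t within J)"
  shows "v \<in> Hol"
proof -
  have L0: "L v = 0" if L: "linear L" "\<And>C. C \<in> Cor_plus \<Longrightarrow> L C = c" for L :: "'a sqmat \<Rightarrow> real" and c
  proof -
    have 1: "((\<lambda>s. L (\<gamma> s)) has_vector_derivative L v) (at t within J)"
      using bounded_linear.has_vector_derivative[OF _ v] L(1)
      unfolding linear_conv_bounded_linear by blast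
    have "((\<lambda>s. L (\<gamma> s)) has_vector_derivative 0) (at t within J)"
      by (rule has_vector_derivative_transform[OF \<open>t \<in> J\<close>, of _ "\<lambda>_. c"]) (simp_all add: L \<gamma>)
    then show ?thesis using vector_derivative_unique_within[OF assms(2) 1] by blast
  qed
  have "v $ i $ i = 0" for i
    by (rule L0[OF linear_entry, of i i 1]) (simp add: Cor_plus_def)
  moreover have "v $ i $ j - v $ j $ i = 0" for i j
  proof (rule L0[of "\<lambda>A. A $ i $ j - A $ j $ i" 0])
    show "linear (\<lambda>A::'a sqmat. A $ i $ j - A $ j $ i)"
      by (rule linearI) (auto simp: algebra_simps)
  qed (simp add: Cor_plus_def transpose_def vec_eq_iff)
  ultimately show ?thesis by (simp add: Hol_def transpose_def vec_eq_iff)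
qed

lemma translate_has_vector_derivative:
  assumes "A \<in> LT0"
  shows "((\<lambda>s. Z ** mexp (s *\<^sub>R A)) has_vector_derivative Z ** mexp (s *\<^sub>R A) ** A) (at s within J)"
  using bounded_linear.has_vector_derivative[OF mm.bounded_linear_right
      mexp_has_vector_derivative[OF assms, of s J], of Z]
  by (simp add: matrix_mul_assoc)

lemma translate_LT1: "Z \<in> LT1 \<Longrightarrow> A \<in> LT0 \<Longrightarrow> Z ** mexp (s *\<^sub>R A) \<in> LT1"
  by (intro LT1_mult mexp_LT1 subspace_scale subspace_LT0)

lemma chart_translate_has_vector_derivative:
  assumes "A \<in> LT0"
  shows "((\<lambda>s. chart (Z ** mexp (s *\<^sub>R A))) has_vector_derivative
    D1 chart (Z ** mexp (s *\<^sub>R A)) (Z ** mexp (s *\<^sub>R A) ** A)) (at s within J)"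
  by (rule twice_diff_has_vector_derivative[OF twice_diff_chart translate_has_vector_derivative[OF assms]])

text \<open>Along z(s) = Z exp(s A) one has z' = z A and z'' = z A A, which is z' z^-1 z'; this
  cancels the value given by \<open>lc_connection_diagonal\<close>.\<close>

lemma translate_geodesic:
  assumes Z: "Z \<in> LT1" and A: "A \<in> LT0"
    and \<gamma>: "\<And>s. s \<in> J \<Longrightarrow> \<gamma> s = chart (Z ** mexp (s *\<^sub>R A))"
  shows "lc_geodesic_on J \<gamma>"
proof -
  define z where "z s = Z ** mexp (s *\<^sub>R A)" for s
  have zL: "z s \<in> LT1" for s unfolding z_def using translate_LT1[OF Z A] .
  have z': "(z has_vector_derivative z s ** A) (at s within J)" for s
    unfolding z_def by (rule translate_has_vector_derivative[OF A])
  have zA': "((\<lambda>s. z s ** A) has_vector_derivative z s ** A ** A) (at s within J)" for s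
    by (rule bounded_linear.has_vector_derivative[OF mm.bounded_linear_left z'])
  show ?thesis
    unfolding lc_geodesic_on_def
  proof (intro exI ballI conjI)
    fix t assume t: "t \<in> J"
    show "\<gamma> t \<in> Cor_plus" using chart_Cor_plus[OF zL] \<gamma>[OF t] by (simp add: z_def)
    show "(\<gamma> has_vector_derivative D1 chart (z t) (z t ** A)) (at t within J)"
      by (rule has_vector_derivative_transform[OF t \<gamma>])
        (use chart_translate_has_vector_derivative[OF A] in \<open>simp_all add: z_def\<close>)
    show "((\<lambda>t. D1 chart (z t) (z t ** A)) has_vector_derivative
        D2 chart (z t) (z t ** A) (z t ** A) + D1 chart (z t) (z t ** A ** A)) (at t within J)"
      by (rule D1_has_vector_derivative[OF twice_diff_chart z' zA'])
    have "z t ** A ** matrix_inv (z t) ** (z t ** A) = z t ** A ** A"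
      using LT1_inverse(3)[OF zL] by (metis matrix_mul_assoc matrix_mul_rid)
    moreover have "Theta (\<gamma> t) = z t" using Theta_chart[OF zL] \<gamma>[OF t] by (simp add: z_def)
    ultimately show "D2 chart (z t) (z t ** A) (z t ** A) + D1 chart (z t) (z t ** A ** A)
        + lc_connection (\<gamma> t) (D1 chart (z t) (z t ** A)) (D1 chart (z t) (z t ** A)) = 0"
      using lc_connection_diagonal[of "\<gamma> t" "z t ** A" "D1 chart (z t) (z t ** A)"] \<open>\<gamma> t \<in> Cor_plus\<close>
        LT0_mult_left[OF LT1_LTs[OF zL] A] by simp
  qed
qed

text \<open>In the chart the geodesic equation reads \<open>z'' = z' z\<^sup>-\<^sup>1 z'\<close>, that is, \<open>z\<^sup>-\<^sup>1 z'\<close> is constant.\<close>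

lemma geodesic_translate:
  assumes J: "is_interval J" and nt: "\<And>t. t \<in> J \<Longrightarrow> at t within J \<noteq> bot" and "0 \<in> J"
    and geod: "lc_geodesic_on J \<gamma>"
  obtains A where "A \<in> LT0" "\<And>s. s \<in> J \<Longrightarrow> \<gamma> s = chart (Theta (\<gamma> 0) ** mexp (s *\<^sub>R A))"
proof -
  obtain v a where g: "\<And>t. t \<in> J \<Longrightarrow> \<gamma> t \<in> Cor_plus"
      "\<And>t. t \<in> J \<Longrightarrow> (\<gamma> has_vector_derivative v t) (at t within J)"
      "\<And>t. t \<in> J \<Longrightarrow> (v has_vector_derivative a t) (at t within J)"
      "\<And>t. t \<in> J \<Longrightarrow> a t + lc_connection (\<gamma> t) (v t) (v t) = 0"
    using geod unfolding lc_geodesic_on_def by blast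
  define z where "z t = Theta (\<gamma> t)" for t
  define u where "u t = diff_at Theta (\<gamma> t) (v t)" for t
  have v: "v t \<in> Hol" if "t \<in> J" for t using has_vector_derivative_Hol[OF that nt[OF that] g(1) g(2)[OF that]] .
  have z: "z t \<in> LT1" "chart (z t) = \<gamma> t" if "t \<in> J" for t
    using g(1)[OF that] by (simp_all add: z_def Theta_LT1 chart_Theta)
  have u: "u t \<in> LT0" "D1 chart (z t) (u t) = v t" if "t \<in> J" for t
    using g(1)[OF that] v[OF that] by (simp_all add: u_def z_def diff_at_Theta_LT0 D1_diff_at_Theta)
  have cv: "((\<lambda>s. chart (z s)) has_vector_derivative D1 chart (z t) (u t)) (at t within J)" if "t \<in> J" for t
    unfolding u(2)[OF that]
    by (rule has_vector_derivative_transform[OF that z(2) g(2)[OF that]])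
  have z': "(z has_vector_derivative u t) (at t within J)" if "t \<in> J" for t
    using lift_curve[where f = chart and u = u, OF twice_diff_chart inj_chart inj_D1_chart that cv[OF that]] .
  have ca: "((\<lambda>s. D1 chart (z s) (u s)) has_vector_derivative a t) (at t within J)" if "t \<in> J" for t
    by (rule has_vector_derivative_transform[OF that u(2) g(3)[OF that]])
  \<comment> \<open>The acceleration computed through the chart is compared with the geodesic
    equation: the \<open>D2\<close> terms cancel, and injectivity of \<open>D1 chart\<close> leaves
    an equation between matrices.\<close>
  have u': "(u has_vector_derivative u t ** matrix_inv (z t) ** u t) (at t within J)" if t: "t \<in> J" for t
  proof -
    let ?q = "u t ** matrix_inv (z t) ** u t"
    obtain w where w: "(u has_vector_derivative w) (at t within J)"
      using lift_velocity[where f = chart and z = z and u = u, OF twice_diff_chart inj_chart inj_D1_chart t cv[OF t] ca[OF t]] by blast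
    have "a t = D2 chart (z t) (u t) (u t) + D1 chart (z t) w"
      by (rule vector_derivative_unique_within[OF nt[OF t] ca[OF t]])
        (rule D1_has_vector_derivative[OF twice_diff_chart z'[OF t] w])
    moreover have "lc_connection (\<gamma> t) (v t) (v t) = - (D2 chart (z t) (u t) (u t) + D1 chart (z t) ?q)"
      using lc_connection_diagonal[OF g(1)[OF t] u(1)[OF t]] u(2)[OF t] by (simp add: z_def)
    ultimately have "D1 chart (z t) w = D1 chart (z t) ?q" using g(4)[OF t] by simp
    then show ?thesis using w injD[OF inj_D1_chart] by metis
  qed
  have "((\<lambda>s. matrix_inv (z s) ** u s) has_vector_derivative 0) (at t within J)" if t: "t \<in> J" for t
  proof -
    have "((\<lambda>s. matrix_inv (z s) ** u s) has_vector_derivative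
        matrix_inv (z t) ** (u t ** matrix_inv (z t) ** u t)
        + - (matrix_inv (z t) ** u t ** matrix_inv (z t)) ** u t) (at t within J)"
      by (rule bounded_bilinear.has_vector_derivative[OF bounded_bilinear_matrix_mult
            matrix_inv_has_vector_derivative[OF t nt[OF t] z(1) z'[OF t]] u'[OF t]])
    then show ?thesis by (simp add: matrix_mul_assoc mm.minus_left)
  qed
  then obtain A where A: "\<And>t. t \<in> J \<Longrightarrow> matrix_inv (z t) ** u t = A"
    using has_vector_derivative_zero_constant[of J] is_interval_convex[OF J] by blast
  have A0: "A \<in> LT0"
    using A[OF \<open>0 \<in> J\<close>] u(1)[OF \<open>0 \<in> J\<close>] LT0_mult_left LT1_LTs LT1_inverse(4) z(1)[OF \<open>0 \<in> J\<close>] by metis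
  have uA: "u t = z t ** A" if "t \<in> J" for t
    using A[OF that] matrix_inv_cancel(1)[OF z(1)[OF that]] by metis
  have nA: "- A \<in> LT0" using A0 subspace_neg[OF subspace_LT0] by blast
  \<comment> \<open>Uniqueness for the linear equation z' = z A: multiplying by the inverse flow
    gives a constant.\<close>
  have "((\<lambda>s. z s ** mexp (s *\<^sub>R - A)) has_vector_derivative 0) (at t within J)" if t: "t \<in> J" for t
  proof -
    have "((\<lambda>s. z s ** mexp (s *\<^sub>R - A)) has_vector_derivative
        z t ** (mexp (t *\<^sub>R - A) ** - A) + u t ** mexp (t *\<^sub>R - A)) (at t within J)"
      by (rule bounded_bilinear.has_vector_derivative[OF bounded_bilinear_matrix_mult z'[OF t]
            mexp_has_vector_derivative[OF nA]])
    moreover have "z t ** (mexp (t *\<^sub>R - A) ** - A) + u t ** mexp (t *\<^sub>R - A) = 0"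
      unfolding mexp_commute[OF nA, symmetric] uA[OF t]
      by (simp add: mm.minus_left mm.minus_right matrix_mul_assoc)
    ultimately show ?thesis by simp
  qed
  then obtain K where K: "\<And>t. t \<in> J \<Longrightarrow> z t ** mexp (t *\<^sub>R - A) = K"
    using has_vector_derivative_zero_constant[of J] is_interval_convex[OF J] by blast
  have "K = z 0" using K[OF \<open>0 \<in> J\<close>] by (simp add: mexp_0)
  have "\<gamma> s = chart (Theta (\<gamma> 0) ** mexp (s *\<^sub>R A))" if s: "s \<in> J" for s
  proof -
    have "z 0 ** mexp (s *\<^sub>R A) = z s ** (mexp (- s *\<^sub>R A) ** mexp (s *\<^sub>R A))"
      using K[OF s] \<open>K = z 0\<close> by (simp add: matrix_mul_assoc)
    also have "\<dots> = z s" by (simp only: mexp_minus(2)[OF A0] matrix_mul_rid)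
    finally show ?thesis using z(2)[OF s] by (simp add: z_def)
  qed
  then show ?thesis using that A0 by blast
qed

text \<open>A connected set with more than one point has no isolated point, so derivatives within
  \<open>J\<close> are unique even at its endpoints.\<close>

lemma interval_nontrivial:
  assumes "is_interval J" "0 \<in> J" "(1::real) \<in> J" "t \<in> J"
  shows "at t within J \<noteq> bot"
proof -
  have "connected J" using assms(1) is_interval_connected by blast
  moreover have "J \<noteq> {x}" for x using assms(2,3) by force
  ultimately show ?thesis
    using connected_imp_perfect[OF _ assms(4)] by (simp add: trivial_limit_within)
qed

section \<open>Exponential map, logarithm map, geodesics and means in coordinates\<close>

lemma mlog_LT1_quotient: "Z \<in> LT1 \<Longrightarrow> W \<in> LT1 \<Longrightarrow> mlog (matrix_inv Z ** W) \<in> LT0"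
  by (simp add: mlog_LT0 LT1_mult LT1_inverse(4))

lemma LT0_quotient: "Z \<in> LT1 \<Longrightarrow> A \<in> LT0 \<Longrightarrow> matrix_inv Z ** A \<in> LT0"
  by (simp add: LT0_mult_left LT1_LTs LT1_inverse(4))

lemma translate_eq_iff:
  assumes "Z \<in> LT1" "A \<in> LT0" "W \<in> LT1"
  shows "Z ** mexp A = W \<longleftrightarrow> A = mlog (matrix_inv Z ** W)"
proof
  assume "Z ** mexp A = W"
  then show "A = mlog (matrix_inv Z ** W)"
    using assms by (metis matrix_inv_cancel(2) mlog_mexp)
next
  assume "A = mlog (matrix_inv Z ** W)"
  then show "Z ** mexp A = W"
    using assms by (simp add: mexp_mlog LT1_mult LT1_inverse(4) matrix_inv_cancel)
qed

text \<open>The definite description is justified because every geodesic is a translate of a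
  one-parameter subgroup, and its initial velocity determines the generator.\<close>

lemma lc_Exp_eq:
  assumes C: "C \<in> Cor_plus" and X: "X \<in> Hol"
  shows "lc_Exp C X = chart (Theta C ** mexp (matrix_inv (Theta C) ** diff_at Theta C X))"
proof -
  let ?Z = "Theta C" and ?J = "{0..1::real}"
  define A where "A = matrix_inv ?Z ** diff_at Theta C X"
  have Z: "?Z \<in> LT1" by (rule Theta_LT1[OF C])
  have A: "A \<in> LT0" unfolding A_def by (rule LT0_quotient[OF Z diff_at_Theta_LT0[OF C X]])
  have nt: "at t within ?J \<noteq> bot" if "t \<in> ?J" for t
    by (rule interval_nontrivial) (use that in \<open>auto simp: is_interval_cc\<close>)
  have velocity: "((\<lambda>s. chart (?Z ** mexp (s *\<^sub>R B))) has_vector_derivative D1 chart ?Z (?Z ** B)) (at 0 within ?J)"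
    if "B \<in> LT0" for B
    using chart_translate_has_vector_derivative[OF that, of ?Z 0] by (simp add: mexp_0)
  have ZA: "?Z ** A = diff_at Theta C X" by (simp add: A_def matrix_inv_cancel[OF Z])
  show ?thesis
    unfolding lc_Exp_def A_def[symmetric]
  proof (rule the_equality)
    show "\<exists>\<gamma>. lc_geodesic_on ?J \<gamma> \<and> \<gamma> 0 = C \<and> (\<gamma> has_vector_derivative X) (at 0 within ?J) \<and>
        \<gamma> 1 = chart (?Z ** mexp A)"
      using translate_geodesic[OF Z A] velocity[OF A]
      by (intro exI[of _ "\<lambda>s. chart (?Z ** mexp (s *\<^sub>R A))"])
        (simp add: mexp_0 chart_Theta[OF C] ZA D1_diff_at_Theta[OF C X])
    fix C' assume "\<exists>\<gamma>. lc_geodesic_on ?J \<gamma> \<and> \<gamma> 0 = C \<and> (\<gamma> has_vector_derivative X) (at 0 within ?J) \<and> \<gamma> 1 = C'"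
    then obtain \<gamma> where \<gamma>: "lc_geodesic_on ?J \<gamma>" "\<gamma> 0 = C" "(\<gamma> has_vector_derivative X) (at 0 within ?J)" "\<gamma> 1 = C'"
      by blast
    obtain B where B: "B \<in> LT0" "\<And>s. s \<in> ?J \<Longrightarrow> \<gamma> s = chart (?Z ** mexp (s *\<^sub>R B))"
      using geodesic_translate[OF _ nt _ \<gamma>(1)] \<gamma>(2) by (auto simp: is_interval_cc)
    have "(\<gamma> has_vector_derivative D1 chart ?Z (?Z ** B)) (at 0 within ?J)"
      by (rule has_vector_derivative_transform[OF _ B(2) velocity[OF B(1)]]) auto
    then have "X = D1 chart ?Z (?Z ** B)"
      using vector_derivative_unique_within[OF nt \<gamma>(3)] by simp
    then have "diff_at Theta C X = ?Z ** B"
      using diff_at_Theta_D1[OF C] LT0_mult_left[OF LT1_LTs[OF Z] B(1)] by simp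
    then have "B = A" unfolding A_def by (simp add: matrix_inv_cancel[OF Z])
    then show "C' = chart (?Z ** mexp A)" using B(2)[of 1] \<gamma>(4) by simp
  qed
qed

lemma lc_Log_eq:
  assumes C: "C \<in> Cor_plus" and C': "C' \<in> Cor_plus"
  shows "lc_Log C C' = D1 chart (Theta C) (Theta C ** mlog (matrix_inv (Theta C) ** Theta C'))"
proof -
  let ?Z = "Theta C" and ?W = "Theta C'"
  have ZW: "?Z \<in> LT1" "?W \<in> LT1" using C C' by (simp_all add: Theta_LT1)
  \<comment> \<open>Solving for \<open>X\<close> by equivalences yields both the injectivity of
    \<open>lc_Exp C\<close> on \<open>Hol\<close> and the value of its inverse.\<close>
  have exp_iff: "lc_Exp C X = C'' \<longleftrightarrow>
      X = D1 chart ?Z (?Z ** mlog (matrix_inv ?Z ** Theta C''))"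
    if X: "X \<in> Hol" and C'': "C'' \<in> Cor_plus" for X C''
  proof -
    let ?A = "matrix_inv ?Z ** diff_at Theta C X" and ?B = "mlog (matrix_inv ?Z ** Theta C'')"
    have A: "?A \<in> LT0" by (rule LT0_quotient[OF ZW(1) diff_at_Theta_LT0[OF C X]])
    have B: "?Z ** ?B \<in> LT0"
      using LT0_mult_left[OF LT1_LTs[OF ZW(1)] mlog_LT1_quotient[OF ZW(1) Theta_LT1[OF C'']]] .
    have "lc_Exp C X = C'' \<longleftrightarrow> ?Z ** mexp ?A = Theta C''"
      unfolding lc_Exp_eq[OF C X]
      using Theta_chart[OF LT1_mult[OF ZW(1) mexp_LT1[OF A]]] chart_Theta[OF C''] by metis
    also have "\<dots> \<longleftrightarrow> ?A = ?B" by (rule translate_eq_iff[OF ZW(1) A Theta_LT1[OF C'']])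
    also have "\<dots> \<longleftrightarrow> diff_at Theta C X = ?Z ** ?B"
      using matrix_inv_cancel[OF ZW(1)] by metis
    also have "\<dots> \<longleftrightarrow> X = D1 chart ?Z (?Z ** ?B)"
      using diff_at_Theta_D1[OF C B] D1_diff_at_Theta[OF C X] by metis
    finally show ?thesis .
  qed
  have E: "lc_Exp C X \<in> Cor_plus" if X: "X \<in> Hol" for X
    unfolding lc_Exp_eq[OF C X]
    by (intro chart_Cor_plus LT1_mult ZW(1) mexp_LT1 LT0_quotient diff_at_Theta_LT0[OF C X])
  have "inj_on (lc_Exp C) Hol"
    using exp_iff E by (metis inj_onI)
  moreover have H: "D1 chart ?Z (?Z ** mlog (matrix_inv ?Z ** ?W)) \<in> Hol"
    by (intro D1_chart_Hol LT0_mult_left LT1_LTs mlog_LT1_quotient ZW)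
  ultimately show ?thesis
    unfolding lc_Log_def by (intro the_inv_into_f_eq) (use exp_iff[OF H C'] H in auto)
qed

lemma diff_inv_at_Theta:
  assumes C: "C \<in> Cor_plus" and H: "H \<in> LT0"
  shows "diff_inv_at Theta C H = D1 chart (Theta C) H"
proof -
  have "inj_on (diff_at Theta C) Hol"
    using D1_diff_at_Theta[OF C] by (metis inj_onI)
  then show ?thesis
    unfolding diff_inv_at_def
    by (intro the_inv_into_f_eq) (simp_all add: diff_at_Theta_D1[OF C H] D1_chart_Hol[OF H])
qed

text \<open>The endpoint at time 1 fixes the generator of the translate as the logarithm of the left
  quotient, so the formula holds on all of \<open>J\<close>.\<close>

lemma lc_geodesic_iff:
  assumes C: "C \<in> Cor_plus" and C': "C' \<in> Cor_plus" and J: "is_interval J" "0 \<in> J" "1 \<in> J"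
  shows "lc_geodesic_on J \<gamma> \<and> \<gamma> 0 = C \<and> \<gamma> 1 = C' \<longleftrightarrow>
    (\<forall>s\<in>J. \<gamma> s = chart (Theta C ** mpowr (matrix_inv (Theta C) ** Theta C') s))"
proof -
  let ?Z = "Theta C" and ?W = "Theta C'"
  let ?A = "mlog (matrix_inv ?Z ** ?W)"
  have ZW: "?Z \<in> LT1" "?W \<in> LT1" using C C' by (simp_all add: Theta_LT1)
  have A: "?A \<in> LT0" by (rule mlog_LT1_quotient[OF ZW])
  have ZA: "?Z ** mexp ?A = ?W" using translate_eq_iff[OF ZW(1) A ZW(2)] by simp
  show ?thesis
    unfolding mpowr_def
  proof (intro iffI ballI conjI)
    fix s
    assume \<gamma>: "lc_geodesic_on J \<gamma> \<and> \<gamma> 0 = C \<and> \<gamma> 1 = C'" and s: "s \<in> J"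
    obtain B where B: "B \<in> LT0" "\<And>s. s \<in> J \<Longrightarrow> \<gamma> s = chart (?Z ** mexp (s *\<^sub>R B))"
      using geodesic_translate[OF J(1) interval_nontrivial[OF J] J(2), of \<gamma>] \<gamma> by metis
    have "chart (?Z ** mexp B) = C'" using B(2)[OF J(3)] \<gamma> by simp
    then have "?Z ** mexp B = ?W" using Theta_chart[OF LT1_mult[OF ZW(1) mexp_LT1[OF B(1)]]] by simp
    then have "B = ?A" using translate_eq_iff[OF ZW(1) B(1) ZW(2)] by simp
    then show "\<gamma> s = chart (?Z ** mexp (s *\<^sub>R ?A))" using B(2)[OF s] by simp
  next
    assume \<gamma>: "\<forall>s\<in>J. \<gamma> s = chart (?Z ** mexp (s *\<^sub>R ?A))"
    then show "lc_geodesic_on J \<gamma>" by (intro translate_geodesic[OF ZW(1) A]) simp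
    show "\<gamma> 0 = C" using \<gamma> J(2) by (simp add: mexp_0 chart_Theta[OF C])
    show "\<gamma> 1 = C'" using \<gamma> J(3) by (simp add: ZA chart_Theta[OF C'])
  qed
qed

text \<open>Left multiplication by \<open>?Z\<close> and \<open>D1 chart ?Z\<close> are linear and
  injective, so they can be pulled out of the sum and cancelled.\<close>

lemma lc_group_mean_iff:
  assumes B: "B \<in> Cor_plus" and Cs: "\<forall>i\<in>{1..k}. Cs i \<in> Cor_plus"
  shows "lc_group_mean k Cs B \<longleftrightarrow> (\<Sum>i = 1..k. mlog (matrix_inv (Theta B) ** Theta (Cs i))) = 0"
proof -
  let ?Z = "Theta B"
  let ?S = "\<Sum>i = 1..k. mlog (matrix_inv ?Z ** Theta (Cs i))"
  have Z: "?Z \<in> LT1" by (rule Theta_LT1[OF B])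
  have "(\<Sum>i = 1..k. lc_Log B (Cs i)) = (\<Sum>i = 1..k. D1 chart ?Z (?Z ** mlog (matrix_inv ?Z ** Theta (Cs i))))"
    using Cs by (intro sum.cong) (auto simp: lc_Log_eq[OF B])
  also have "\<dots> = D1 chart ?Z (?Z ** ?S)"
    by (simp add: linear_sum[OF linear_D1[OF twice_diff_chart]] mm.sum_right)
  finally have "lc_group_mean k Cs B \<longleftrightarrow> D1 chart ?Z (?Z ** ?S) = D1 chart ?Z 0"
    using B by (simp add: lc_group_mean_def linear_0[OF linear_D1[OF twice_diff_chart]])
  also have "\<dots> \<longleftrightarrow> ?Z ** ?S = 0" using inj_D1_chart[THEN inj_eq] .
  also have "\<dots> \<longleftrightarrow> ?S = 0" using matrix_inv_cancel(2)[OF Z, of ?S] by auto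
  finally show ?thesis .
qed

lemma ex1_lc_group_mean:
  assumes "1 \<le> k" and Cs: "\<forall>i\<in>{1..k}. Cs i \<in> Cor_plus"
  shows "\<exists>!B. lc_group_mean k Cs B"
proof -
  let ?S = "\<lambda>Z. \<Sum>i = 1..k. mlog (matrix_inv Z ** Theta (Cs i))"
  have iff: "lc_group_mean k Cs B \<longleftrightarrow> B \<in> Cor_plus \<and> ?S (Theta B) = 0" for B
    using lc_group_mean_iff[OF _ Cs] by (auto simp: lc_group_mean_def)
  have ex1: "\<exists>!Z. Z \<in> LT1 \<and> ?S Z = 0"
    using ex1_mlog_sum_eq_0[OF assms(1), of "\<lambda>i. Theta (Cs i)"] Cs Theta_LT1 by blast
  then obtain Z where Z: "Z \<in> LT1" "?S Z = 0" by blast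
  show ?thesis
  proof (rule ex1I[of _ "chart Z"])
    show "lc_group_mean k Cs (chart Z)" using Z by (simp add: iff chart_Cor_plus Theta_chart)
    fix B assume "lc_group_mean k Cs B"
    then have B: "B \<in> Cor_plus" "?S (Theta B) = 0" by (simp_all add: iff)
    then have "Theta B = Z" using ex1 Z Theta_LT1[OF B(1)] by blast
    then show "B = chart Z" using chart_Theta[OF B(1)] by simp
  qed
qed

theorem theorem4p8:
  fixes C C' X :: "real ^ 'n::{finite,wellorder} ^ 'n::{finite,wellorder}"
    and Cs :: "nat \<Rightarrow> real ^ 'n::{finite,wellorder} ^ 'n::{finite,wellorder}"
    and k :: nat and t :: real
  assumes "C \<in> Cor_plus" and "C' \<in> Cor_plus" and "X \<in> Hol"
    and "k \<ge> 1" and "\<forall>i\<in>{1..k}. Cs i \<in> Cor_plus"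
  shows
    "lc_Exp C (t *\<^sub>R X) =
       Theta_inv (Theta C ** mexp (t *\<^sub>R (matrix_inv (Theta C) ** diff_at Theta C X)))
     \<and> lc_Log C C' =
       diff_inv_at Theta C (Theta C ** mlog (matrix_inv (Theta C) ** Theta C'))
     \<and> (\<forall>J \<gamma>. is_interval J \<and> 0 \<in> J \<and> 1 \<in> J \<longrightarrow>
         (lc_geodesic_on J \<gamma> \<and> \<gamma> 0 = C \<and> \<gamma> 1 = C' \<longleftrightarrow>
           (\<forall>s\<in>J. \<gamma> s =
              Theta_inv (Theta C ** mpowr (matrix_inv (Theta C) ** Theta C') s))))
     \<and> (\<exists>!Cbar. lc_group_mean k Cs Cbar)
     \<and> (\<forall>Cbar\<in>Cor_plus. lc_group_mean k Cs Cbar \<longleftrightarrow>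
         (\<Sum>i = 1..k. mlog (matrix_inv (Theta Cbar) ** Theta (Cs i))) = 0)"
proof (intro conjI)
  let ?Z = "Theta C" and ?A = "matrix_inv (Theta C) ** diff_at Theta C X"
  have Z: "?Z \<in> LT1" "Theta C' \<in> LT1" using assms Theta_LT1 by auto
  have A: "?A \<in> LT0" by (rule LT0_quotient[OF Z(1) diff_at_Theta_LT0[OF assms(1,3)]])
  have "t *\<^sub>R X \<in> Hol" using assms(3) by (simp add: Hol_def transpose_def vec_eq_iff)
  then have "lc_Exp C (t *\<^sub>R X) = chart (?Z ** mexp (t *\<^sub>R ?A))"
    by (simp add: lc_Exp_eq assms(1) linear_scale[OF linear_diff_at_Theta[OF assms(1)]] mm.scaleR_right)
  then show "lc_Exp C (t *\<^sub>R X) = Theta_inv (?Z ** mexp (t *\<^sub>R ?A))"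
    by (simp add: Theta_inv_eq_chart translate_LT1[OF Z(1) A])
  show "lc_Log C C' = diff_inv_at Theta C (?Z ** mlog (matrix_inv ?Z ** Theta C'))"
    using diff_inv_at_Theta[OF assms(1)] LT0_mult_left[OF LT1_LTs[OF Z(1)] mlog_LT1_quotient[OF Z]]
    by (simp add: lc_Log_eq[OF assms(1,2)])
  have "Theta_inv (?Z ** mpowr (matrix_inv ?Z ** Theta C') s)
      = chart (?Z ** mpowr (matrix_inv ?Z ** Theta C') s)" for s
    unfolding mpowr_def by (intro Theta_inv_eq_chart translate_LT1 Z mlog_LT1_quotient)
  then show "\<forall>J \<gamma>. is_interval J \<and> 0 \<in> J \<and> 1 \<in> J \<longrightarrow>
      (lc_geodesic_on J \<gamma> \<and> \<gamma> 0 = C \<and> \<gamma> 1 = C' \<longleftrightarrow>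
        (\<forall>s\<in>J. \<gamma> s = Theta_inv (?Z ** mpowr (matrix_inv ?Z ** Theta C') s)))"
    using lc_geodesic_iff[OF assms(1,2)] by simp
  show "\<exists>!Cbar. lc_group_mean k Cs Cbar" by (rule ex1_lc_group_mean[OF assms(4,5)])
  show "\<forall>Cbar\<in>Cor_plus. lc_group_mean k Cs Cbar \<longleftrightarrow>
      (\<Sum>i = 1..k. mlog (matrix_inv (Theta Cbar) ** Theta (Cs i))) = 0"
    using lc_group_mean_iff[OF _ assms(5)] by blast
qed

end
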